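(* Fix the number $m$ of alternatives. Under the Impartial Anonymous Culture assumption with $n$ agents, the probability that the Dodgson Quick (DQ) rule and the Tideman rule pick the same winners converges to $1$ as $n\to\infty$. Likewise, under the Impartial Anonymous Culture assumption, the probability that the Dodgson Relaxed (DR), Dodgson Clone (DC), Dodgson Relaxed and Rounded (D&) and Dodgson rules pick the same winners converges to $1$ as $n\to\infty$.
   Context: Let $\mathcal{A}$ be a finite set of $m$ alternatives. A profile is an array $\mathcal{P}=(P_1,\ldots,P_n)$ of $n$ votes, each vote being a linear order of $\mathcal{A}$; $xP_iy$ means that the $i$-th vote ranks $x$ above $y$. A voting situation is a multiset of $n$ linear orders of $\mathcal{A}$ (it forgets who submitted which vote). The Impartial Anonymous Culture (IAC) assumption is that each voting situation with $n$ agents is equally likely. Put $n_{xy}=\#\{i\mid xP_iy\}$ and $\mathrm{adv}(a,b)=\max(0,n_{ab}-n_{ba})$; these and all scores below depend only on the voting situation. An alternative $a$ is a Condorcet-tie winner if $\mathrm{adv}(b,a)=0$ for all alternatives $b\neq a$. The winners under each of the following rules are the alternatives with the lowest score. Tideman score: $\mathrm{Sc}_{\mathbf T}(a)=\sum_{b\ne a}\mathrm{adv}(b,a)$. DQ score: $\mathrm{Sc}_{\mathbf Q}(a)=\sum_{b\neq a}F(b,a)$ with $F(b,a)=\lceil \mathrm{adv}(b,a)/2\rceil$. Dodgson score: $\mathrm{Sc}_{\mathbf D}(a)$ is the minimum number of swaps of neighbouring alternatives (within votes) required to make $a$ a Condorcet-tie winner. DC score: $\mathrm{Sc}_{\mathbf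 C}(a)=\min_{k\ge1}\frac{\mathrm{Sc}_{\mathbf D}[\mathcal{P}^k](a)}{k}$, where $\mathcal{P}^k$ is the profile in which each agent is replaced by $k$ clones and $\mathrm{Sc}_{\mathbf D}[\mathcal{P}^k](a)$ is the Dodgson score of $a$ in it. DR score: $\mathrm{Sc}_{\mathbf R}(a)$ is defined as the Dodgson score, but votes may be split into rational fractions (a swap on a fraction $w$ of a vote counts $w$), and it is required that, for each $b\ne a$, $a$ be swapped over $b$ at least $F(b,a)$ times in total. Explicitly, it is the minimum of $\sum_{i,j} j\,x_{ij}$ over rational $x_{ij}\ge 0$ (with $i$ ranging over the votes and $x_{ij}$ the fraction of vote $i$ in which $a$ is moved up $j$ positions) subject to $\sum_j x_{ij}=1$ for each $i$ and $\sum_{i,j}e_{ijb}x_{ij}\ge F(b,a)$ for each $b\neq a$, where $e_{ijb}=1$ if moving $a$ up $j$ positions in vote $i$ raises $a$ above $b$ and $e_{ijb}=0$ otherwise. D& score: $\mathrm{Sc}_{\mathbf \&}(a)=\lceil \mathrm{Sc}_{\mathbf R}(a)\rceil$. *)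

theory Defs
  imports "HOL-Probability.Probability" "HOL-Combinatorics.Multiset_Permutations"
begin

text \<open>
  A linear order of the finite set \<^term>\<open>A\<close> of alternatives is represented by the list
  of the elements of \<^term>\<open>A\<close> from the top-ranked to the bottom-ranked one, i.e. by an
  element of \<^term>\<open>permutations_of_set A\<close>.
\<close>

type_synonym 'a vote = "'a list"
type_synonym 'a profile = "'a vote list"

definition prefers :: "'a vote \<Rightarrow> 'a \<Rightarrow> 'a \<Rightarrow> bool" where
  "prefers v x y \<longleftrightarrow> (\<exists>i j. i < j \<and> j < length v \<and> v ! i = x \<and> v ! j = y)"

definition n_prefer :: "'a profile \<Rightarrow> 'a \<Rightarrow> 'a \<Rightarrow> nat" where
  "n_prefer P x y = card {i. i < length P \<and> prefers (P ! i) x y}"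

definition adv :: "'a profile \<Rightarrow> 'a \<Rightarrow> 'a \<Rightarrow> int" where
  "adv P a b = max 0 (int (n_prefer P a b) - int (n_prefer P b a))"

definition condorcet_tie_winner :: "'a set \<Rightarrow> 'a profile \<Rightarrow> 'a \<Rightarrow> bool" where
  "condorcet_tie_winner A P a \<longleftrightarrow> (\<forall>b \<in> A - {a}. adv P b a = 0)"

definition winners :: "'a set \<Rightarrow> ('a \<Rightarrow> 'b::linorder) \<Rightarrow> 'a set" where
  "winners A sc = {a \<in> A. \<forall>b \<in> A. sc a \<le> sc b}"

definition tideman_score :: "'a set \<Rightarrow> 'a profile \<Rightarrow> 'a \<Rightarrow> int" where
  "tideman_score A P a = (\<Sum>b \<in> A - {a}. adv P b a)"

definition F_req :: "'a profile \<Rightarrow> 'a \<Rightarrow> 'a \<Rightarrow> int" where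
  "F_req P b a = \<lceil>(of_int (adv P b a) / 2 :: rat)\<rceil>"

definition dq_score :: "'a set \<Rightarrow> 'a profile \<Rightarrow> 'a \<Rightarrow> int" where
  "dq_score A P a = (\<Sum>b \<in> A - {a}. F_req P b a)"

definition neighbour_swap :: "'a profile \<Rightarrow> 'a profile \<Rightarrow> bool" where
  "neighbour_swap P Q \<longleftrightarrow>
     (\<exists>i j. i < length P \<and> Suc j < length (P ! i) \<and>
            Q = P[i := (P ! i)[j := P ! i ! Suc j, Suc j := P ! i ! j]])"

definition dodgson_score :: "'a set \<Rightarrow> 'a profile \<Rightarrow> 'a \<Rightarrow> nat" where
  "dodgson_score A P a =
     (LEAST k. \<exists>Q. (neighbour_swap ^^ k) P Q \<and> condorcet_tie_winner A Q a)"

definition clones :: "nat \<Rightarrow> 'a profile \<Rightarrow> 'a profile" where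
  "clones k P = concat (map (replicate k) P)"

text \<open>The minima over \<^typ>\<open>rat\<close> in \<open>dc_score\<close> and \<open>dr_score\<close>, taken by
  \<^const>\<open>Least\<close>, are attained for every profile over \<^term>\<open>A\<close> and every
  \<^term>\<open>a \<in> A\<close>: both are optimal values of feasible bounded rational linear programs.\<close>

definition dc_score :: "'a set \<Rightarrow> 'a profile \<Rightarrow> 'a \<Rightarrow> rat" where
  "dc_score A P a =
     (LEAST q. \<exists>k\<ge>1. q = of_nat (dodgson_score A (clones k P) a) / of_nat k)"

definition n_above :: "'a vote \<Rightarrow> 'a \<Rightarrow> nat" where
  "n_above v a = card {b. prefers v b a}"

text \<open>Here \<^term>\<open>j\<close> is at most \<^term>\<open>n_above v a\<close>, the number of positions that
  \<^term>\<open>a\<close> can be moved up in \<^term>\<open>v\<close>.\<close>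

definition move_up :: "'a vote \<Rightarrow> 'a \<Rightarrow> nat \<Rightarrow> 'a vote" where
  "move_up v a j = take (n_above v a - j) (remove1 a v) @ a # drop (n_above v a - j) (remove1 a v)"

definition raises_above :: "'a vote \<Rightarrow> 'a \<Rightarrow> nat \<Rightarrow> 'a \<Rightarrow> bool" where
  "raises_above v a j b \<longleftrightarrow> prefers v b a \<and> prefers (move_up v a j) a b"

definition dr_feasible :: "'a set \<Rightarrow> 'a profile \<Rightarrow> 'a \<Rightarrow> (nat \<Rightarrow> nat \<Rightarrow> rat) \<Rightarrow> bool" where
  "dr_feasible A P a x \<longleftrightarrow>
     (\<forall>i < length P. \<forall>j \<le> n_above (P ! i) a. x i j \<ge> 0) \<and>
     (\<forall>i < length P. (\<Sum>j \<le> n_above (P ! i) a. x i j) = 1) \<and>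
     (\<forall>b \<in> A - {a}.
        (\<Sum>i < length P. \<Sum>j \<le> n_above (P ! i) a. of_bool (raises_above (P ! i) a j b) * x i j)
          \<ge> of_int (F_req P b a))"

definition dr_score :: "'a set \<Rightarrow> 'a profile \<Rightarrow> 'a \<Rightarrow> rat" where
  "dr_score A P a =
     (LEAST c. \<exists>x. dr_feasible A P a x \<and>
                   c = (\<Sum>i < length P. \<Sum>j \<le> n_above (P ! i) a. of_nat j * x i j))"

definition dand_score :: "'a set \<Rightarrow> 'a profile \<Rightarrow> 'a \<Rightarrow> int" where
  "dand_score A P a = \<lceil>dr_score A P a\<rceil>"

definition voting_situations :: "'a set \<Rightarrow> nat \<Rightarrow> 'a vote multiset set" where
  "voting_situations A n = multisets_of_size (permutations_of_set A) n"

definition IAC :: "'a set \<Rightarrow> nat \<Rightarrow> 'a vote multiset pmf" where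
  "IAC A n = pmf_of_set (voting_situations A n)"

text \<open>An event about profiles, as an event about voting situations: it holds for every way of
  distributing the votes of the situation among the agents.  For events defined from the scores
  above, which depend only on the voting situation, this is the same as holding for some way.\<close>

definition situation_event :: "('a profile \<Rightarrow> bool) \<Rightarrow> 'a vote multiset set" where
  "situation_event E = {V. \<forall>P. mset P = V \<longrightarrow> E P}"

end

theory Submission
  imports Defs
begin

text \<open>
  Write \<open>m\<close> for the number of alternatives and \<open>N\<close> for the number of linear orders of them.
  The theorem combines two facts.

  Within each of the two families of rules, the scores are close to a reference score, with an
  error that depends on the set of alternatives but not on the number \<open>n\<close> of agents. For DQ and
  Tideman, twice the DQ score exceeds the Tideman score by at most \<open>m\<close>, since each ceiling rounds
  up by at most 1/2 (\<open>dq_score_bounds\<close>). For the second family the reference is the Dodgson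
  score, which is the optimal value of an integer program (\<open>dodgson_score_le\<close>,
  \<open>dodgson_schedule\<close>): its variables count, for each linear order \<open>t\<close> and each alternative \<open>c\<close>
  ranked above \<open>a\<close> in \<open>t\<close>, the votes of type \<open>t\<close> in which \<open>a\<close> is raised above \<open>c\<close>. The DR and DC
  scores are the optimal values of rational relaxations of this program (\<open>dr_score_optimum\<close>,
  \<open>dc_score_optimum\<close>). Rounding up a rational solution keeps it feasible and costs at most 1 for
  each variable, and the number of variables is independent of \<open>n\<close>
  (\<open>schedule_optimum_close_to_dodgson\<close>). The D& score lies between DR and Dodgson. Consequently,
  if the reference scores of any two alternatives differ by more than twice the error, all rules
  of the family rank the alternatives in the same way (\<open>winners_of_close_score\<close>).

  It remains to see that two different alternatives \<open>a\<close> and \<open>b\<close> rarely have reference scores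
  within a constant \<open>K\<close> of each other. Let \<open>v\<close> be a linear order with \<open>b\<close> first and \<open>a\<close> last, and
  let \<open>v'\<close> arise from \<open>v\<close> by exchanging the two. Replacing one vote \<open>v\<close> by \<open>v'\<close> makes the score
  of \<open>a\<close> minus the score of \<open>b\<close> strictly smaller (\<open>gap_swap_extremes\<close>). As this difference is an
  integer, each chain of voting situations that arise from each other by such replacements has at
  most \<open>2 * K + 1\<close> members with a difference in the range from \<open>-K\<close> to \<open>K\<close>
  (\<open>card_close_scores\<close>). The number of chains is the number of multisets of \<open>n\<close> votes over only
  \<open>N - 1\<close> linear orders, which is the fraction \<open>(N - 1) / (N + n - 1)\<close> of the number of all
  voting situations and so becomes negligible (\<open>almost_all_situations\<close>).

  The minima over the rationals that define the DR and DC scores exist by Fourier-Motzkin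
  elimination (\<open>fourier_motzkin\<close>, \<open>polyhedral_minimum\<close>).
\<close>

section \<open>Minima of linear programs over the rationals\<close>

text \<open>
  The constraints with a negative coefficient bound \<open>y\<close> from below and those with a positive
  one from above. Finitely many such bounds can be met together as soon as each lower bound is
  at most each upper bound.
\<close>

lemma one_variable_elimination:
  fixes \<alpha> r :: "'c \<Rightarrow> rat"
  assumes "finite C"
  shows "(\<exists>y. \<forall>p\<in>C. \<alpha> p * y \<le> r p) \<longleftrightarrow>
         (\<forall>p\<in>C. \<alpha> p = 0 \<longrightarrow> 0 \<le> r p) \<and>
         (\<forall>p\<in>C. \<forall>n\<in>C. \<alpha> p > 0 \<and> \<alpha> n < 0 \<longrightarrow> r n / \<alpha> n \<le> r p / \<alpha> p)"
    (is "?L \<longleftrightarrow> ?R")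
proof
  assume ?L
  then obtain y where y: "\<And>p. p \<in> C \<Longrightarrow> \<alpha> p * y \<le> r p"
    by blast
  have "r n / \<alpha> n \<le> y" if "n \<in> C" "\<alpha> n < 0" for n
    using y[OF that(1)] that(2) by (simp add: divide_le_eq mult.commute)
  moreover have "y \<le> r p / \<alpha> p" if "p \<in> C" "\<alpha> p > 0" for p
    using y[OF that(1)] that(2) by (simp add: le_divide_eq mult.commute)
  ultimately show ?R
    using y by (metis mult_zero_left order_trans)
next
  assume R: ?R
  define lo where "lo = (\<lambda>p. r p / \<alpha> p) ` {n \<in> C. \<alpha> n < 0}"
  define hi where "hi = (\<lambda>p. r p / \<alpha> p) ` {p \<in> C. \<alpha> p > 0}"
  have fin: "finite lo" "finite hi"
    using assms by (auto simp: lo_def hi_def)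
  have between: "l \<le> h" if "l \<in> lo" "h \<in> hi" for l h
    using that R by (auto simp: lo_def hi_def)
  obtain y where y: "\<And>l. l \<in> lo \<Longrightarrow> l \<le> y" "\<And>h. h \<in> hi \<Longrightarrow> y \<le> h"
  proof (cases "lo = {}")
    case False
    with fin between show ?thesis
      by (intro that[of "Max lo"]) auto
  next
    case True
    with fin show ?thesis
      by (cases "hi = {}") (auto intro: that[of "Min hi"])
  qed
  have "\<alpha> p * y \<le> r p" if "p \<in> C" for p
  proof (cases "\<alpha> p" "0 :: rat" rule: linorder_cases)
    case less
    with y(1)[of "r p / \<alpha> p"] that show ?thesis
      by (auto simp: lo_def divide_le_eq mult.commute)
  next
    case equal
    with R that show ?thesis by auto
  next
    case greater
    with y(2)[of "r p / \<alpha> p"] that show ?thesis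
      by (auto simp: hi_def le_divide_eq mult.commute)
  qed
  thus ?L by blast
qed

text \<open>
  Eliminating the variables \<open>z\<close> one at a time leaves a finite system in the parameter \<open>q\<close>
  alone: the projection of a rational polyhedron is again described by finitely many rational
  inequalities.
\<close>

lemma fourier_motzkin:
  fixes C :: "(('v \<Rightarrow> rat) \<times> rat \<times> rat) set"
  assumes "finite W" "finite C"
  shows "\<exists>D. finite D \<and>
           (\<forall>q. (\<exists>z. \<forall>(f, g, \<beta>)\<in>C. (\<Sum>v\<in>W. f v * z v) + g * q \<le> \<beta>) \<longleftrightarrow>
                (\<forall>(g, \<beta>)\<in>D. g * q \<le> \<beta>))"
  using assms
proof (induction W arbitrary: C rule: finite_induct)
  case empty
  then show ?case
    by (intro exI[of _ "snd ` C"]) auto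
next
  case (insert u W)
  \<comment> \<open>The positive constraint divided by its coefficient of \<open>u\<close> minus the negative one divided by
    its own: \<open>u\<close> cancels, and what remains says that the lower bound is at most the upper bound.\<close>
  define comb :: "('v \<Rightarrow> rat) \<times> rat \<times> rat \<Rightarrow> ('v \<Rightarrow> rat) \<times> rat \<times> rat \<Rightarrow> ('v \<Rightarrow> rat) \<times> rat \<times> rat"
    where "comb = (\<lambda>(f, g, \<beta>) (f', g', \<beta>').
      (\<lambda>v. f v / f u - f' v / f' u, g / f u - g' / f' u, \<beta> / f u - \<beta>' / f' u))"
  define C0 where "C0 = {p \<in> C. fst p u = 0}"
  define C1 where "C1 = case_prod comb ` ({p \<in> C. fst p u > 0} \<times> {p \<in> C. fst p u < 0})"
  have "finite (C0 \<union> C1)"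
    using insert.prems by (auto simp: C0_def C1_def)
  then obtain D where D: "finite D"
    "\<And>q. (\<exists>z. \<forall>(f, g, \<beta>)\<in>C0 \<union> C1. (\<Sum>v\<in>W. f v * z v) + g * q \<le> \<beta>) \<longleftrightarrow>
         (\<forall>(g, \<beta>)\<in>D. g * q \<le> \<beta>)"
    using insert.IH[of "C0 \<union> C1"] by blast
  have step: "(\<exists>z. \<forall>(f, g, \<beta>)\<in>C. (\<Sum>v\<in>insert u W. f v * z v) + g * q \<le> \<beta>) \<longleftrightarrow>
              (\<exists>z. \<forall>(f, g, \<beta>)\<in>C0 \<union> C1. (\<Sum>v\<in>W. f v * z v) + g * q \<le> \<beta>)" for q
  proof -
    define r where "r = (\<lambda>z (f, g, \<beta>). \<beta> - g * q - (\<Sum>v\<in>W. f v * z v))"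
      for z :: "'v \<Rightarrow> rat"
    have "(\<exists>z. \<forall>(f, g, \<beta>)\<in>C. (\<Sum>v\<in>insert u W. f v * z v) + g * q \<le> \<beta>) \<longleftrightarrow>
          (\<exists>z y. \<forall>p\<in>C. fst p u * y \<le> r z p)"
    proof safe
      fix z assume "\<forall>(f, g, \<beta>)\<in>C. (\<Sum>v\<in>insert u W. f v * z v) + g * q \<le> \<beta>"
      hence "\<forall>p\<in>C. fst p u * z u \<le> r z p"
        using insert.hyps by (fastforce simp: r_def)
      thus "\<exists>z y. \<forall>p\<in>C. fst p u * y \<le> r z p" by blast
    next
      fix z y assume *: "\<forall>p\<in>C. fst p u * y \<le> r z p"
      have "(\<Sum>v\<in>W. f v * (z(u := y)) v) = (\<Sum>v\<in>W. f v * z v)" for f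
        using insert.hyps by (intro sum.cong) auto
      hence "\<forall>(f, g, \<beta>)\<in>C. (\<Sum>v\<in>insert u W. f v * (z(u := y)) v) + g * q \<le> \<beta>"
        using * insert.hyps by (fastforce simp: r_def)
      thus "\<exists>z. \<forall>(f, g, \<beta>)\<in>C. (\<Sum>v\<in>insert u W. f v * z v) + g * q \<le> \<beta>" by blast
    qed
    also have "\<dots> \<longleftrightarrow> (\<exists>z. (\<forall>p\<in>C. fst p u = 0 \<longrightarrow> 0 \<le> r z p) \<and>
        (\<forall>p\<in>C. \<forall>n\<in>C. fst p u > 0 \<and> fst n u < 0 \<longrightarrow> r z n / fst n u \<le> r z p / fst p u))"
      by (subst one_variable_elimination[OF insert.prems]) (rule refl)
    also have "\<dots> \<longleftrightarrow> (\<exists>z. (\<forall>p\<in>C0. 0 \<le> r z p) \<and> (\<forall>p\<in>C1. 0 \<le> r z p))"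
    proof -
      have comb: "0 \<le> r z (comb p n) \<longleftrightarrow> r z n / fst n u \<le> r z p / fst p u" for z p n
      proof -
        have "r z (comb p n) = r z p / fst p u - r z n / fst n u"
          by (cases p; cases n)
             (simp add: comb_def r_def diff_divide_distrib sum_divide_distrib
                sum_subtractf left_diff_distrib)
        thus ?thesis by simp
      qed
      have "(\<forall>p\<in>C1. 0 \<le> r z p) \<longleftrightarrow>
          (\<forall>p\<in>C. \<forall>n\<in>C. fst p u > 0 \<and> fst n u < 0 \<longrightarrow> r z n / fst n u \<le> r z p / fst p u)" for z
        unfolding C1_def comb[symmetric] by auto
      moreover have "(\<forall>p\<in>C0. 0 \<le> r z p) \<longleftrightarrow> (\<forall>p\<in>C. fst p u = 0 \<longrightarrow> 0 \<le> r z p)" for z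
        unfolding C0_def by auto
      ultimately show ?thesis by simp
    qed
    also have "\<dots> \<longleftrightarrow> (\<exists>z. \<forall>(f, g, \<beta>)\<in>C0 \<union> C1. (\<Sum>v\<in>W. f v * z v) + g * q \<le> \<beta>)"
      by (intro arg_cong[where f = Ex] ext) (auto simp: r_def algebra_simps ball_Un)
    finally show ?thesis .
  qed
  show ?case
    using D(1) unfolding step D(2) by (intro exI[of _ D]) simp
qed

text \<open>
  A finite system of weak inequalities in one unknown describes an intersection of closed
  half-lines. If it is bounded below, some inequality bounds it from below, and the largest of
  these lower bounds belongs to it.
\<close>

lemma halflines_minimum:
  fixes D :: "(rat \<times> rat) set"
  assumes "finite D" and q0: "\<forall>(g, \<beta>)\<in>D. g * q0 \<le> \<beta>"
    and bound: "\<And>q. \<forall>(g, \<beta>)\<in>D. g * q \<le> \<beta> \<Longrightarrow> 0 \<le> q"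
  shows "\<exists>q. (\<forall>(g, \<beta>)\<in>D. g * q \<le> \<beta>) \<and> (\<forall>q'. (\<forall>(g, \<beta>)\<in>D. g * q' \<le> \<beta>) \<longrightarrow> q \<le> q')"
proof -
  define L where "L = (\<lambda>(g, \<beta>). \<beta> / g) ` {(g, \<beta>)\<in>D. g < 0}"
  have fin: "finite L"
    using assms(1) by (auto simp: L_def intro: finite_subset[of _ D])
  have lower: "l \<le> q" if "l \<in> L" "\<forall>(g, \<beta>)\<in>D. g * q \<le> \<beta>" for l q
    using that by (auto simp: L_def divide_le_eq mult.commute)
  have downward: "\<forall>(g, \<beta>)\<in>D. g * q \<le> \<beta>" if "\<And>l. l \<in> L \<Longrightarrow> l \<le> q" "q \<le> q0" for q
  proof safe
    fix g \<beta> assume gb: "(g, \<beta>) \<in> D"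
    show "g * q \<le> \<beta>"
    proof (cases "g < 0")
      case True
      with gb that(1)[of "\<beta> / g"] show ?thesis
        by (force simp: L_def divide_le_eq mult.commute)
    next
      case False
      with that(2) have "g * q \<le> g * q0" by (intro mult_left_mono) auto
      with gb q0 show ?thesis by fastforce
    qed
  qed
  have "L \<noteq> {}"
  proof
    assume "L = {}"
    hence "0 \<le> min q0 (-1)" by (intro bound downward) auto
    thus False by simp
  qed
  moreover have "Max L \<le> q" if "\<forall>(g, \<beta>)\<in>D. g * q \<le> \<beta>" for q
    using that calculation fin lower by simp
  moreover have "\<forall>(g, \<beta>)\<in>D. g * Max L \<le> \<beta>"
    using fin calculation(2)[OF q0] by (intro downward) simp_all
  ultimately show ?thesis by blast
qed

definition polyhedral :: "'v set \<Rightarrow> (('v \<Rightarrow> rat) \<Rightarrow> bool) \<Rightarrow> bool" where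
  "polyhedral W R \<longleftrightarrow> (\<exists>C. finite C \<and> (\<forall>z. R z \<longleftrightarrow> (\<forall>(f, \<beta>)\<in>C. (\<Sum>v\<in>W. f v * z v) \<le> \<beta>)))"

text \<open>
  A linear objective that is bounded below on a nonempty rational polyhedron attains its minimum
  at a rational point. This is what turns the infima over \<open>rat\<close> in the DR and DC scores into
  minima.
\<close>

lemma polyhedral_minimum:
  fixes z0 c :: "'v \<Rightarrow> rat"
  assumes "finite W" "polyhedral W R" "R z0"
    and bound: "\<And>z. R z \<Longrightarrow> 0 \<le> (\<Sum>v\<in>W. c v * z v)"
  shows "\<exists>z. R z \<and> (\<forall>z'. R z' \<longrightarrow> (\<Sum>v\<in>W. c v * z v) \<le> (\<Sum>v\<in>W. c v * z' v))"
proof -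
  obtain C where C: "finite C" "\<And>z. R z \<longleftrightarrow> (\<forall>(f, \<beta>)\<in>C. (\<Sum>v\<in>W. f v * z v) \<le> \<beta>)"
    using assms(2) unfolding polyhedral_def by blast
  \<comment> \<open>The value of the objective becomes a parameter \<open>q\<close>, tied to the objective by two
    inequalities. Eliminating the variables then describes the set of values of the objective.\<close>
  define E where "E = (\<lambda>(f, \<beta>). (f, 0 :: rat, \<beta>)) ` C \<union> {(c, - 1, 0), (\<lambda>v. - c v, 1, 0)}"
  have "finite E" using C(1) by (simp add: E_def)
  from fourier_motzkin[OF assms(1) this] obtain D where D: "finite D"
    "\<And>q. (\<exists>z. \<forall>(f, g, \<beta>)\<in>E. (\<Sum>v\<in>W. f v * z v) + g * q \<le> \<beta>) \<longleftrightarrow> (\<forall>(g, \<beta>)\<in>D. g * q \<le> \<beta>)"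
    by blast
  have E: "(\<forall>(f, g, \<beta>)\<in>E. (\<Sum>v\<in>W. f v * z v) + g * q \<le> \<beta>) \<longleftrightarrow>
      R z \<and> q = (\<Sum>v\<in>W. c v * z v)" for z q
    unfolding C(2) E_def by (auto simp: sum_negf)
  have D': "(\<forall>(g, \<beta>)\<in>D. g * q \<le> \<beta>) \<longleftrightarrow> (\<exists>z. R z \<and> q = (\<Sum>v\<in>W. c v * z v))" for q
    unfolding D(2)[symmetric] E by (rule refl)
  show ?thesis
    proof -
    have "\<exists>q. (\<exists>z. R z \<and> q = (\<Sum>v\<in>W. c v * z v)) \<and>
              (\<forall>q'. (\<exists>z. R z \<and> q' = (\<Sum>v\<in>W. c v * z v)) \<longrightarrow> q \<le> q')"
      unfolding D'[symmetric]
    proof (rule halflines_minimum[OF D(1)])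
      show "\<forall>(g, \<beta>)\<in>D. g * (\<Sum>v\<in>W. c v * z0 v) \<le> \<beta>"
        unfolding D' using assms(3) by blast
      show "0 \<le> q" if "\<forall>(g, \<beta>)\<in>D. g * q \<le> \<beta>" for q
        using that bound unfolding D' by blast
    qed
    thus ?thesis by blast
  qed
qed

lemma polyhedral_conj:
  assumes "polyhedral W R" "polyhedral W S"
  shows "polyhedral W (\<lambda>z. R z \<and> S z)"
proof -
  obtain C where "finite C" "\<And>z. R z \<longleftrightarrow> (\<forall>(f, \<beta>)\<in>C. (\<Sum>v\<in>W. f v * z v) \<le> \<beta>)"
    using assms(1) unfolding polyhedral_def by blast
  moreover obtain D where "finite D" "\<And>z. S z \<longleftrightarrow> (\<forall>(f, \<beta>)\<in>D. (\<Sum>v\<in>W. f v * z v) \<le> \<beta>)"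
    using assms(2) unfolding polyhedral_def by blast
  ultimately show ?thesis
    unfolding polyhedral_def by (intro exI[of _ "C \<union> D"]) (simp add: ball_Un)
qed

lemma polyhedral_halfspaces:
  assumes "finite I" "\<And>i z. i \<in> I \<Longrightarrow> R i z \<longleftrightarrow> (\<Sum>v\<in>W. f i v * z v) \<le> \<beta> i"
  shows "polyhedral W (\<lambda>z. \<forall>i\<in>I. R i z)"
proof -
  have "(\<forall>i\<in>I. R i z) \<longleftrightarrow> (\<forall>(f, \<beta>)\<in>(\<lambda>i. (f i, \<beta> i)) ` I. (\<Sum>v\<in>W. f v * z v) \<le> \<beta>)" for z
    using assms(2)[where z = z] by simp
  with assms(1) show ?thesis
    unfolding polyhedral_def by (intro exI[of _ "(\<lambda>i. (f i, \<beta> i)) ` I"]) simp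
qed

section \<open>Votes and swaps of neighbours\<close>

lemma prefers_Nil [simp]: "\<not> prefers [] x y"
  by (simp add: prefers_def)

lemma prefers_Cons [simp]: "prefers (z # v) x y \<longleftrightarrow> x = z \<and> y \<in> set v \<or> prefers v x y"
proof
  assume "prefers (z # v) x y"
  then obtain i j where ij: "i < j" "j < length (z # v)" "(z # v) ! i = x" "(z # v) ! j = y"
    unfolding prefers_def by blast
  then obtain j' where j': "j = Suc j'" by (cases j) auto
  show "x = z \<and> y \<in> set v \<or> prefers v x y"
  proof (cases i)
    case 0
    with ij j' show ?thesis by auto
  next
    case (Suc i')
    with ij j' have "i' < j' \<and> j' < length v \<and> v ! i' = x \<and> v ! j' = y" by simp
    thus ?thesis unfolding prefers_def by blast
  qed
next
  assume "x = z \<and> y \<in> set v \<or> prefers v x y"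
  thus "prefers (z # v) x y"
  proof
    assume *: "x = z \<and> y \<in> set v"
    then obtain j where "j < length v" "v ! j = y" by (auto simp: in_set_conv_nth)
    with * show ?thesis
      unfolding prefers_def by (intro exI[of _ 0] exI[of _ "Suc j"]) simp
  next
    assume "prefers v x y"
    then obtain i j where "i < j" "j < length v" "v ! i = x" "v ! j = y"
      unfolding prefers_def by blast
    thus ?thesis
      unfolding prefers_def by (intro exI[of _ "Suc i"] exI[of _ "Suc j"]) simp
  qed
qed

lemma prefers_append [simp]:
  "prefers (u @ v) x y \<longleftrightarrow> prefers u x y \<or> prefers v x y \<or> x \<in> set u \<and> y \<in> set v"
  by (induction u) auto

lemma prefers_in_set:
  assumes "prefers v x y"
  shows "x \<in> set v" "y \<in> set v"
  using assms by (induction v) auto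

lemma prefers_iff_split:
  assumes "distinct (u @ a # v)"
  shows "prefers (u @ a # v) c a \<longleftrightarrow> c \<in> set u"
  using assms by (auto dest: prefers_in_set)

lemma n_above_split:
  assumes "distinct (u @ a # v)"
  shows "n_above (u @ a # v) a = length u"
  using assms by (simp add: n_above_def prefers_iff_split distinct_card del: prefers_append)

lemma n_above_nth:
  assumes "distinct v" "i < length v"
  shows "n_above v (v ! i) = i"
  using assms n_above_split[of "take i v" "v ! i" "drop (Suc i) v"]
  by (simp add: id_take_nth_drop[symmetric])

text \<open>
  On a linear order, \<^const>\<open>n_above\<close> is the position counted from the top, starting at 0.
\<close>

lemma prefers_iff_n_above:
  assumes "distinct v" "x \<in> set v" "y \<in> set v"
  shows "prefers v x y \<longleftrightarrow> n_above v x < n_above v y"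
proof -
  obtain i j where ij: "i < length v" "x = v ! i" "j < length v" "y = v ! j"
    using assms by (auto simp: in_set_conv_nth)
  have "prefers v x y \<longleftrightarrow> i < j"
    unfolding prefers_def using ij assms(1) by (auto simp: nth_eq_iff_index_eq)
  thus ?thesis using ij assms(1) by (simp add: n_above_nth)
qed

lemma n_above_inject:
  assumes "distinct v" "x \<in> set v" "y \<in> set v"
  shows "n_above v x = n_above v y \<longleftrightarrow> x = y"
  using assms by (auto simp: in_set_conv_nth n_above_nth)

lemma prefers_asym:
  assumes "distinct v" "prefers v x y"
  shows "\<not> prefers v y x"
  using assms prefers_in_set[OF assms(2)] by (simp add: prefers_iff_n_above)

lemma prefers_total:
  assumes "distinct v" "x \<in> set v" "y \<in> set v" "x \<noteq> y"
  shows "prefers v x y \<or> prefers v y x"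
  using assms n_above_inject[OF assms(1-3)] by (auto simp: prefers_iff_n_above)

lemma prefers_trans:
  assumes "distinct v" "prefers v x y" "prefers v y z"
  shows "prefers v x z"
  using assms prefers_in_set[OF assms(2)] prefers_in_set[OF assms(3)]
  by (simp add: prefers_iff_n_above)

text \<open>
  Moving \<open>a\<close> up passes exactly the alternatives whose distance above \<open>a\<close> is at most the
  number of positions moved.
\<close>

lemma raises_above_iff:
  assumes "distinct v" "a \<in> set v"
  shows "raises_above v a j b \<longleftrightarrow> prefers v b a \<and> n_above v a - n_above v b \<le> j"
proof -
  obtain u w where v: "v = u @ a # w"
    using assms(2) by (auto simp: in_set_conv_decomp)
  have na: "n_above v a = length u"
    using assms(1) unfolding v by (rule n_above_split)
  have "remove1 a v = u @ w"
    using assms(1) by (simp add: v remove1_append)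
  hence up: "move_up v a j = take (length u - j) u @ a # (drop (length u - j) u @ w)"
    by (simp add: move_up_def na)
  show ?thesis
  proof (cases "prefers v b a")
    case False
    thus ?thesis by (simp add: raises_above_def)
  next
    case True
    hence "b \<in> set u"
      using assms(1) unfolding v by (simp add: prefers_iff_split del: prefers_append)
    then obtain i where i: "i < length u" "b = u ! i"
      by (auto simp: in_set_conv_nth)
    have b: "n_above v b = i"
      using n_above_nth[OF assms(1), of i] i by (simp add: v nth_append)
    have pos: "b \<in> set (drop (length u - j) u) \<longleftrightarrow> length u - i \<le> j"
    proof
      assume "b \<in> set (drop (length u - j) u)"
      then obtain l where "l < length u - (length u - j)" "u ! (length u - j + l) = u ! i"
        using i by (auto simp: in_set_conv_nth)
      hence "length u - j + l = i"
        using assms(1) i by (subst (asm) nth_eq_iff_index_eq) (auto simp: v)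
      thus "length u - i \<le> j" by simp
    next
      assume "length u - i \<le> j"
      thus "b \<in> set (drop (length u - j) u)"
        using i by (auto simp: in_set_conv_nth intro!: exI[of _ "i - (length u - j)"])
    qed
    have a: "a \<notin> set u" "a \<notin> set w" and bw: "b \<notin> set w"
      using assms(1) \<open>b \<in> set u\<close> by (auto simp: v)
    have "a \<notin> set (take (length u - j) u)" "a \<notin> set (drop (length u - j) u)"
      using a(1) by (auto dest: in_set_takeD in_set_dropD)
    hence "\<not> prefers (take (length u - j) u) a b" "\<not> prefers (drop (length u - j) u) a b"
      "\<not> prefers w a b"
      using a(2) prefers_in_set(1) by metis+
    hence "prefers (move_up v a j) a b \<longleftrightarrow> b \<in> set (drop (length u - j) u)"
      using bw \<open>a \<notin> set (take (length u - j) u)\<close> \<open>a \<notin> set (drop (length u - j) u)\<close> a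
      unfolding up by simp
    thus ?thesis using True pos by (simp add: raises_above_def na b)
  qed
qed

definition vote_swap :: "'a vote \<Rightarrow> 'a vote \<Rightarrow> bool" where
  "vote_swap v v' \<longleftrightarrow> (\<exists>u x y w. v = u @ x # y # w \<and> v' = u @ y # x # w)"

lemma neighbour_swap_iff:
  "neighbour_swap P Q \<longleftrightarrow> (\<exists>i<length P. \<exists>v. vote_swap (P ! i) v \<and> Q = P[i := v])"
proof -
  have *: "vote_swap p v \<longleftrightarrow> (\<exists>j. Suc j < length p \<and> v = p[j := p ! Suc j, Suc j := p ! j])"
    for p v :: "'a vote"
  proof
    assume "vote_swap p v"
    then obtain u x y w where "p = u @ x # y # w" "v = u @ y # x # w"
      unfolding vote_swap_def by blast
    thus "\<exists>j. Suc j < length p \<and> v = p[j := p ! Suc j, Suc j := p ! j]"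
      by (intro exI[of _ "length u"]) (simp add: nth_append list_update_append)
  next
    assume "\<exists>j. Suc j < length p \<and> v = p[j := p ! Suc j, Suc j := p ! j]"
    then obtain j where j: "Suc j < length p" "v = p[j := p ! Suc j, Suc j := p ! j]" by blast
    define u w where "u = take j p" and "w = drop (Suc (Suc j)) p"
    have p: "p = u @ p ! j # p ! Suc j # w"
      using j(1) by (simp add: u_def w_def Cons_nth_drop_Suc)
    have "length u = j" using j(1) by (simp add: u_def)
    hence "v = u @ p ! Suc j # p ! j # w"
      by (subst j(2), subst p) (simp add: list_update_append)
    with p show "vote_swap p v" unfolding vote_swap_def by blast
  qed
  show ?thesis unfolding neighbour_swap_def * by blast
qed

lemma relpowp_neighbour_swap_Cons1:
  assumes "(vote_swap ^^ k) v v'"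
  shows "(neighbour_swap ^^ k) (v # P) (v' # P)"
  using assms
proof (induction k arbitrary: v')
  case (Suc k)
  then obtain u where u: "(vote_swap ^^ k) v u" "vote_swap u v'" by auto
  have "neighbour_swap (u # P) (v' # P)"
    using u(2) unfolding neighbour_swap_iff by (intro exI[of _ 0]) auto
  with Suc.IH[OF u(1)] show ?case by auto
qed simp

lemma relpowp_neighbour_swap_Cons2:
  assumes "(neighbour_swap ^^ k) P Q"
  shows "(neighbour_swap ^^ k) (v # P) (v # Q)"
  using assms
proof (induction k arbitrary: Q)
  case (Suc k)
  then obtain R where R: "(neighbour_swap ^^ k) P R" "neighbour_swap R Q" by auto
  then obtain i u where "i < length R" "vote_swap (R ! i) u" "Q = R[i := u]"
    unfolding neighbour_swap_iff by blast
  hence "neighbour_swap (v # R) (v # Q)"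
    unfolding neighbour_swap_iff by (intro exI[of _ "Suc i"]) auto
  with Suc.IH[OF R(1)] show ?case by auto
qed simp

text \<open>
  Every swap acts on a single vote and swaps in different votes commute, so a sequence of swaps
  is determined by one sequence of swaps for each vote.
\<close>

lemma relpowp_neighbour_swap_iff:
  "(neighbour_swap ^^ k) P Q \<longleftrightarrow>
     length Q = length P \<and>
     (\<exists>\<kappa>. (\<Sum>i<length P. \<kappa> i) = k \<and> (\<forall>i<length P. (vote_swap ^^ \<kappa> i) (P ! i) (Q ! i)))"
    (is "_ \<longleftrightarrow> ?R k Q")
proof
  show "(neighbour_swap ^^ k) P Q \<Longrightarrow> ?R k Q"
  proof (induction k arbitrary: Q)
    case 0
    thus ?case by (auto intro!: exI[of _ "\<lambda>_. 0"])
  next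
    case (Suc k)
    then obtain S where "(neighbour_swap ^^ k) P S" and S: "neighbour_swap S Q" by auto
    with Suc.IH obtain \<kappa> where \<kappa>: "length S = length P" "(\<Sum>i<length P. \<kappa> i) = k"
      "\<And>i. i < length P \<Longrightarrow> (vote_swap ^^ \<kappa> i) (P ! i) (S ! i)"
      by blast
    from S \<kappa>(1) obtain i v where i: "i < length P" "vote_swap (S ! i) v" "Q = S[i := v]"
      unfolding neighbour_swap_iff by auto
    have "(\<Sum>l<length P. (\<kappa>(i := Suc (\<kappa> i))) l) = Suc k"
      using \<kappa>(2) i(1) by (simp add: sum.remove[of "{..<length P}" i])
    moreover have "(vote_swap ^^ (\<kappa>(i := Suc (\<kappa> i))) l) (P ! l) (Q ! l)" if "l < length P" for l
      using i \<kappa>(1) \<kappa>(3)[OF that] that by (auto simp: nth_list_update)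
    ultimately show ?case
      using i(3) \<kappa>(1) by (intro conjI exI[of _ "\<kappa>(i := Suc (\<kappa> i))"]) auto
  qed
next
  assume "?R k Q"
  thus "(neighbour_swap ^^ k) P Q"
  proof (induction P arbitrary: k Q)
    case (Cons v P)
    then obtain \<kappa> where \<kappa>: "length Q = Suc (length P)" "(\<Sum>i<Suc (length P). \<kappa> i) = k"
      "\<And>i. i < Suc (length P) \<Longrightarrow> (vote_swap ^^ \<kappa> i) ((v # P) ! i) (Q ! i)"
      by auto
    then obtain v' Q' where Q: "Q = v' # Q'" "length Q' = length P"
      by (cases Q) auto
    have "(vote_swap ^^ \<kappa> (Suc i)) (P ! i) (Q' ! i)" if "i < length P" for i
      using \<kappa>(3)[of "Suc i"] that by (simp add: Q)
    hence "(neighbour_swap ^^ (\<Sum>i<length P. \<kappa> (Suc i))) P Q'"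
      using Q(2) by (intro Cons.IH) (auto intro!: exI[of _ "\<lambda>i. \<kappa> (Suc i)"])
    hence "(neighbour_swap ^^ (\<Sum>i<length P. \<kappa> (Suc i))) (v' # P) (v' # Q')"
      by (rule relpowp_neighbour_swap_Cons2)
    moreover have "(neighbour_swap ^^ \<kappa> 0) (v # P) (v' # P)"
      using \<kappa>(3)[of 0] by (intro relpowp_neighbour_swap_Cons1) (simp add: Q)
    moreover have "k = \<kappa> 0 + (\<Sum>i<length P. \<kappa> (Suc i))"
      using \<kappa>(2) by (simp only: sum.lessThan_Suc_shift)
    ultimately show ?case
      by (auto simp: relpowp_add Q)
  qed auto
qed

text \<open>
  The truncated difference \<open>n_above v a - n_above v c\<close> is the distance by which \<open>c\<close> is above
  \<open>a\<close>, and 0 if \<open>c\<close> is below \<open>a\<close>. It drops by at most 1 in a swap: a swap of \<open>a\<close> and \<open>c\<close>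
  with each other changes the positions by 2 relative to each other, but only from distance 1 to
  the opposite order, where truncation gives 0. Hence it is a potential that bounds the number of
  swaps needed to bring \<open>a\<close> above \<open>c\<close> from below.
\<close>

lemma vote_swap_n_above:
  assumes "distinct v" "vote_swap v v'" "a \<in> set v" "c \<in> set v"
  shows "n_above v a - n_above v c \<le> Suc (n_above v' a - n_above v' c)"
proof -
  obtain u x y w where v: "v = u @ x # y # w" and v': "v' = u @ y # x # w"
    using assms(2) unfolding vote_swap_def by blast
  have dist: "distinct v'" using assms(1) by (auto simp: v v')
  have "n_above v x = length u"
    unfolding v using assms(1) by (intro n_above_split) (simp add: v)
  moreover have "n_above v' y = length u"
    unfolding v' using dist by (intro n_above_split) (simp add: v')
  moreover have "n_above v y = Suc (length u)"
    using n_above_split[of "u @ [x]" y w] assms(1) by (auto simp: v)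
  moreover have "n_above v' x = Suc (length u)"
    using n_above_split[of "u @ [y]" x w] dist by (auto simp: v')
  moreover have "n_above v' z = n_above v z" if "z \<noteq> x" "z \<noteq> y" for z
    unfolding n_above_def v v' by (rule arg_cong[where f = card]) (use that in auto)
  moreover have "x \<noteq> y" using assms(1) by (auto simp: v)
  moreover have "n_above v a \<noteq> n_above v x" if "a \<noteq> x" using that assms n_above_inject[of v a x]
    by (auto simp: v)
  moreover have "n_above v c \<noteq> n_above v y" if "c \<noteq> y" using that assms n_above_inject[of v c y]
    by (auto simp: v)
  ultimately show ?thesis
    by (cases "a = x"; cases "a = y"; cases "c = x"; cases "c = y") auto
qed

lemma relpowp_vote_swap_permutation:
  assumes "(vote_swap ^^ k) v v'"
  shows "distinct v' \<longleftrightarrow> distinct v" "set v' = set v"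
proof -
  have "(distinct v' \<longleftrightarrow> distinct v) \<and> set v' = set v"
    using assms
  proof (induction k arbitrary: v')
    case (Suc k)
    then obtain u where u: "(vote_swap ^^ k) v u" "vote_swap u v'" by auto
    from u(2) have "(distinct v' \<longleftrightarrow> distinct u) \<and> set v' = set u"
      unfolding vote_swap_def by auto
    with Suc.IH[OF u(1)] show ?case by simp
  qed simp
  thus "distinct v' \<longleftrightarrow> distinct v" "set v' = set v" by auto
qed

lemma relpowp_vote_swap_n_above:
  assumes "distinct v" "(vote_swap ^^ k) v v'" "a \<in> set v" "c \<in> set v"
  shows "n_above v a - n_above v c \<le> k + (n_above v' a - n_above v' c)"
  using assms(2)
proof (induction k arbitrary: v')
  case (Suc k)
  then obtain u where u: "(vote_swap ^^ k) v u" "vote_swap u v'" by auto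
  have "n_above u a - n_above u c \<le> Suc (n_above v' a - n_above v' c)"
    using relpowp_vote_swap_permutation[OF u(1)] u(2) assms
    by (intro vote_swap_n_above) auto
  with Suc.IH[OF u(1)] show ?case by simp
qed simp

lemma relpowp_vote_swap_rise:
  "(vote_swap ^^ length u) (w @ u @ a # z) (w @ a # u @ z)"
proof (induction u arbitrary: z rule: rev_induct)
  case (snoc x u)
  have "vote_swap (w @ (u @ [x]) @ a # z) (w @ u @ a # x # z)"
    unfolding vote_swap_def by (intro exI[of _ "w @ u"]) auto
  thus ?case
    using snoc[of "x # z"] by (auto intro: relpowp_Suc_I2 simp del: relpowp.simps)
qed simp

text \<open>
  The alternatives in \<open>U\<close> form a block directly above \<open>a\<close>, and moving \<open>a\<close> over that block
  takes one swap for each of its members.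
\<close>

lemma vote_raise:
  assumes "distinct v" "a \<in> set v"
    and above: "\<And>c. c \<in> U \<Longrightarrow> prefers v c a"
    and closed: "\<And>c c'. c \<in> U \<Longrightarrow> prefers v c c' \<Longrightarrow> prefers v c' a \<Longrightarrow> c' \<in> U"
  shows "\<exists>v'. (vote_swap ^^ card U) v v' \<and> (\<forall>c. prefers v' c a \<longleftrightarrow> prefers v c a \<and> c \<notin> U)"
proof -
  obtain u z where v: "v = u @ a # z"
    using assms(2) by (auto simp: in_set_conv_decomp)
  have pref: "prefers v c a \<longleftrightarrow> c \<in> set u" for c
    using assms(1) unfolding v by (rule prefers_iff_split)
  define w r where "w = takeWhile (\<lambda>c. c \<notin> U) u" and "r = dropWhile (\<lambda>c. c \<notin> U) u"
  have u: "u = w @ r" by (simp add: w_def r_def)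
  have "set r = U"
  proof (cases r)
    case Nil
    hence "set u \<inter> U = {}" by (auto simp: r_def dropWhile_eq_Nil_conv)
    with above pref Nil show ?thesis by auto
  next
    case (Cons c r')
    hence "c \<in> U" unfolding r_def by (metis hd_dropWhile list.discI list.sel(1))
    moreover have "prefers v c c'" if "c' \<in> set r'" for c'
      using that by (simp add: v u Cons)
    moreover have "prefers v c' a" if "c' \<in> set r" for c'
      unfolding pref u using that by simp
    ultimately have "c' \<in> U" if "c' \<in> set r" for c'
      using that closed[of c c'] unfolding Cons by (cases "c' = c") simp_all
    moreover have "c' \<in> set r" if "c' \<in> U" for c'
    proof -
      have "c' \<notin> set w" using that by (auto simp: w_def dest: set_takeWhileD)
      moreover have "c' \<in> set u" using above[OF that] pref by simp
      ultimately show ?thesis unfolding u by simp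
    qed
    ultimately show ?thesis by blast
  qed
  have "distinct (w @ a # r @ z)" using assms(1) by (auto simp: v u)
  hence pref': "prefers (w @ a # r @ z) c a \<longleftrightarrow> c \<in> set w" for c
    by (rule prefers_iff_split)
  have "card U = length r"
    using assms(1) \<open>set r = U\<close> distinct_card[of r] by (auto simp: v u)
  moreover have "c \<in> set w \<longleftrightarrow> c \<in> set u \<and> c \<notin> U" for c
    using assms(1) \<open>set r = U\<close> by (auto simp: v u)
  ultimately show ?thesis
    using relpowp_vote_swap_rise[of r w a z] pref pref'
    by (intro exI[of _ "w @ a # r @ z"]) (simp add: v u del: prefers_append prefers_Cons)
qed

section \<open>Majorities\<close>

lemma profile_nth:
  assumes "set P \<subseteq> permutations_of_set A" "i < length P"
  shows "distinct (P ! i)" "set (P ! i) = A" "P ! i \<in> permutations_of_set A"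
  using assms nth_mem[of i P] by (auto dest!: subsetD simp: permutations_of_set_def)

lemma n_prefer_eq_length_filter: "n_prefer P x y = length (filter (\<lambda>v. prefers v x y) P)"
  by (simp add: n_prefer_def length_filter_conv_card)

lemma n_prefer_Cons: "n_prefer (v # P) x y = of_bool (prefers v x y) + n_prefer P x y"
  by (simp add: n_prefer_eq_length_filter)

lemma n_prefer_eq_sum: "n_prefer P x y = (\<Sum>i | i < length P \<and> prefers (P ! i) x y. 1)"
  by (simp add: n_prefer_def)

lemma n_prefer_mset_cong:
  assumes "mset P = mset Q"
  shows "n_prefer P = n_prefer Q"
  using assms
  by (intro ext) (metis n_prefer_eq_length_filter mset_filter size_mset)

lemma n_prefer_add:
  assumes "set P \<subseteq> permutations_of_set A" "x \<in> A" "y \<in> A" "x \<noteq> y"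
  shows "n_prefer P x y + n_prefer P y x = length P"
  using assms(1)
proof (induction P)
  case (Cons v P)
  hence "distinct v" "set v = A" by (auto dest: permutations_of_setD)
  with assms have "of_bool (prefers v x y) + of_bool (prefers v y x) = (1 :: nat)"
    using prefers_total[of v x y] prefers_asym[of v x y] by auto
  with Cons show ?case by (simp add: n_prefer_Cons)
qed (simp add: n_prefer_def)

text \<open>
  Half of the signed majority of \<open>b\<close> over \<open>a\<close>: the number of votes in which \<open>b\<close> is above \<open>a\<close>
  that have to be reversed for \<open>a\<close> to tie with \<open>b\<close>. Unlike \<^const>\<open>F_req\<close> it is linear in the
  votes, hence scales under cloning.
\<close>

definition margin :: "'a profile \<Rightarrow> 'a \<Rightarrow> 'a \<Rightarrow> rat" where
  "margin P a b = (of_nat (n_prefer P b a) - of_nat (n_prefer P a b)) / 2"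

lemma margin_mset_cong:
  assumes "mset P = mset Q"
  shows "margin P = margin Q"
  using n_prefer_mset_cong[OF assms] by (simp add: margin_def fun_eq_iff)

lemma margin_le_n_prefer: "margin P a b \<le> of_nat (n_prefer P b a)"
  by (simp add: margin_def)

lemma condorcet_tie_winner_iff:
  "condorcet_tie_winner A P a \<longleftrightarrow> (\<forall>b\<in>A - {a}. n_prefer P b a \<le> n_prefer P a b)"
  unfolding condorcet_tie_winner_def adv_def by (intro ball_cong refl) linarith

section \<open>Schedules of raises\<close>

text \<open>
  The index set of the variables in the integer and linear programs for \<open>a\<close>. Its size does not
  depend on the profile.
\<close>

definition slots :: "'a set \<Rightarrow> 'a \<Rightarrow> ('a vote \<times> 'a) set" where
  "slots A a = (SIGMA t : permutations_of_set A. {c. prefers t c a})"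

text \<open>
  A plan for improving the standing of \<open>a\<close>, recorded by vote type instead of by voter:
  \<open>y (t, c)\<close> is the amount of votes of type \<open>t\<close> in which \<open>a\<close> is moved above \<open>c\<close>. When \<open>a\<close>
  passes \<open>c\<close> it passes everything between them first, hence the monotonicity in \<open>c\<close>. The demand
  \<open>d b\<close> is the amount of votes in which \<open>a\<close> must pass \<open>b\<close>. Since \<open>a\<close> pays one swap for each
  alternative passed, the cost of a plan is the sum of \<open>y\<close> over all slots. The Dodgson score is
  the least cost of an integral schedule, and the DR and DC scores are least costs of rational
  ones.
\<close>

definition schedule ::
    "'a set \<Rightarrow> 'a profile \<Rightarrow> 'a \<Rightarrow> ('a \<Rightarrow> rat) \<Rightarrow> ('a vote \<times> 'a \<Rightarrow> rat) \<Rightarrow> bool" where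
  "schedule A P a d y \<longleftrightarrow>
     (\<forall>(t, c)\<in>slots A a. 0 \<le> y (t, c)) \<and>
     (\<forall>(t, c)\<in>slots A a. y (t, c) \<le> of_nat (count (mset P) t)) \<and>
     (\<forall>(t, c, c')\<in>{(t, c, c'). (t, c') \<in> slots A a \<and> prefers t c c'}. y (t, c) \<le> y (t, c')) \<and>
     (\<forall>b\<in>A - {a}. d b \<le> (\<Sum>t | (t, b) \<in> slots A a. y (t, b)))"

lemma finite_above: "finite {c. prefers t c a}"
  by (rule finite_subset[of _ "set t"]) (auto dest: prefers_in_set)

lemma finite_slots: "finite (slots A a)"
  unfolding slots_def by (intro finite_SigmaI finite_above) simp

lemma slots_voteD:
  assumes "(t, c) \<in> slots A a"
  shows "t \<in> permutations_of_set A" "prefers t c a" "distinct t" "set t = A" "c \<in> A" "a \<in> A"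
  using assms prefers_in_set[of t c a] by (auto simp: slots_def dest: permutations_of_setD)

lemma slots_upward:
  assumes "(t, c') \<in> slots A a" "prefers t c c'"
  shows "(t, c) \<in> slots A a"
  using assms slots_voteD[OF assms(1)] prefers_trans[of t c c' a] by (simp add: slots_def)

lemma finite_slots_above: "finite {t. (t, b) \<in> slots A a}"
  by (rule finite_subset[of _ "permutations_of_set A"]) (auto simp: slots_def)

lemma schedule_cong:
  assumes "\<And>s. s \<in> slots A a \<Longrightarrow> y s = z s"
  shows "schedule A P a d y \<longleftrightarrow> schedule A P a d z"
proof -
  have "(\<Sum>t | (t, b) \<in> slots A a. y (t, b)) = (\<Sum>t | (t, b) \<in> slots A a. z (t, b))" for b
    using assms by (intro sum.cong) auto
  moreover have "y (t, c) \<le> y (t, c') \<longleftrightarrow> z (t, c) \<le> z (t, c')"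
    if "(t, c') \<in> slots A a" "prefers t c c'" for t c c'
    using assms that slots_upward[OF that] by simp
  ultimately show ?thesis
    using assms unfolding schedule_def by (intro arg_cong2[where f = "(\<and>)"] ball_cong refl) auto
qed

lemma schedule_mset_cong:
  assumes "mset P = mset Q"
  shows "schedule A P = schedule A Q"
  using assms by (simp add: schedule_def fun_eq_iff)

lemma schedule_demand_mono:
  assumes "schedule A P a d y" "\<And>b. b \<in> A - {a} \<Longrightarrow> d' b \<le> d b"
  shows "schedule A P a d' y"
  using assms unfolding schedule_def by (meson order_trans)

lemma sum_by_vote:
  fixes h :: "nat \<Rightarrow> 'b::comm_monoid_add"
  assumes "set P \<subseteq> permutations_of_set A"
  shows "(\<Sum>t | (t, b) \<in> slots A a. \<Sum>i | i < length P \<and> P ! i = t. h i) =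
         (\<Sum>i | i < length P \<and> prefers (P ! i) b a. h i)"
proof -
  let ?S = "{i. i < length P \<and> prefers (P ! i) b a}"
  have "(\<Sum>t | (t, b) \<in> slots A a. \<Sum>i | i < length P \<and> P ! i = t. h i) =
        (\<Sum>t | (t, b) \<in> slots A a. sum h {i \<in> ?S. P ! i = t})"
    by (intro sum.cong refl arg_cong[where f = "sum h"]) (auto simp: slots_def)
  also have "\<dots> = sum h ?S"
    using assms nth_mem by (intro sum.group finite_slots_above) (fastforce simp: slots_def)+
  finally show ?thesis .
qed

lemma sum_slots_by_vote:
  fixes h :: "nat \<Rightarrow> 'a \<Rightarrow> 'b::comm_monoid_add"
  assumes "set P \<subseteq> permutations_of_set A"
  shows "(\<Sum>(t, c)\<in>slots A a. \<Sum>i | i < length P \<and> P ! i = t. h i c) =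
         (\<Sum>i<length P. \<Sum>c | prefers (P ! i) c a. h i c)"
proof -
  have "(\<Sum>(t, c)\<in>slots A a. \<Sum>i | i < length P \<and> P ! i = t. h i c) =
        (\<Sum>t\<in>permutations_of_set A. \<Sum>c | prefers t c a. \<Sum>i | i < length P \<and> P ! i = t. h i c)"
    unfolding slots_def by (subst sum.Sigma) (auto intro: finite_above)
  also have "\<dots> = (\<Sum>t\<in>permutations_of_set A.
      \<Sum>i\<in>{i \<in> {..<length P}. P ! i = t}. \<Sum>c | prefers (P ! i) c a. h i c)"
    by (intro sum.cong refl, subst sum.swap) (auto intro!: sum.cong)
  also have "\<dots> = (\<Sum>i<length P. \<Sum>c | prefers (P ! i) c a. h i c)"
    using assms by (intro sum.group) auto
  finally show ?thesis .
qed

lemma count_eq_sum: "count (mset P) t = (\<Sum>i | i < length P \<and> P ! i = t. 1)"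
  by (simp add: count_mset count_list_eq_length_filter length_filter_conv_card eq_commute)

lemma sum_count_above:
  assumes "set P \<subseteq> permutations_of_set A"
  shows "(\<Sum>t | (t, b) \<in> slots A a. count (mset P) t) = n_prefer P b a"
  unfolding count_eq_sum n_prefer_eq_sum by (rule sum_by_vote[OF assms])

text \<open>
  The distances to \<open>a\<close> of the alternatives above \<open>a\<close> are exactly 1, 2, 3 and so on, up to the
  number of these alternatives.
\<close>

lemma card_above_within:
  assumes "distinct v" "a \<in> set v"
  shows "card {c. prefers v c a \<and> n_above v a - n_above v c \<le> j} = min j (n_above v a)"
proof -
  let ?S = "{c. prefers v c a \<and> n_above v a - n_above v c \<le> j}"
  have pos: "prefers v c a \<longleftrightarrow> c \<in> set v \<and> n_above v c < n_above v a" for c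
    using assms prefers_in_set(1)[of v c a] prefers_iff_n_above[of v c a] by blast
  have lt: "n_above v a < length v"
    using assms by (auto simp: in_set_conv_nth n_above_nth)
  have "bij_betw (\<lambda>c. n_above v a - n_above v c) ?S {1..min j (n_above v a)}"
  proof (rule bij_betw_byWitness[where f' = "\<lambda>l. v ! (n_above v a - l)"])
    show "\<forall>c\<in>?S. v ! (n_above v a - (n_above v a - n_above v c)) = c"
      using assms(1) by (auto simp: pos in_set_conv_nth n_above_nth)
    show "\<forall>l\<in>{1..min j (n_above v a)}. n_above v a - n_above v (v ! (n_above v a - l)) = l"
      using assms lt by (auto simp: n_above_nth)
    show "(\<lambda>c. n_above v a - n_above v c) ` ?S \<subseteq> {1..min j (n_above v a)}"
      by (auto simp: pos)
    show "(\<lambda>l. v ! (n_above v a - l)) ` {1..min j (n_above v a)} \<subseteq> ?S"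
      using assms lt by (auto simp: n_above_nth pos)
  qed
  thus ?thesis by (simp add: bij_betw_same_card)
qed

section \<open>The Dodgson score as an integer program\<close>

text \<open>
  Any way of making \<open>a\<close> a Condorcet-tie winner costs at least as much as some integral schedule.
  If \<open>\<kappa> i\<close> swaps are spent on vote \<open>i\<close>, they bring \<open>a\<close> above no more than the alternatives at
  distance at most \<open>\<kappa> i\<close>, so raising \<open>a\<close> by \<open>\<kappa> i\<close> positions (or to the top) does at least
  as well in that vote.
\<close>

lemma schedule_of_swaps:
  assumes P: "set P \<subseteq> permutations_of_set A" and "a \<in> A"
    and swaps: "(neighbour_swap ^^ k) P Q" and winner: "condorcet_tie_winner A Q a"
  shows "\<exists>y. schedule A P a (margin P a) (\<lambda>s. of_nat (y s)) \<and> (\<Sum>s\<in>slots A a. y s) \<le> k"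
proof -
  obtain \<kappa> where len: "length Q = length P" and \<kappa>: "(\<Sum>i<length P. \<kappa> i) = k"
    "\<And>i. i < length P \<Longrightarrow> (vote_swap ^^ \<kappa> i) (P ! i) (Q ! i)"
    using swaps unfolding relpowp_neighbour_swap_iff by blast
  note perm = profile_nth[OF P]
  have perm': "distinct (Q ! i)" "set (Q ! i) = A" if "i < length P" for i
    using perm[OF that] relpowp_vote_swap_permutation[OF \<kappa>(2)[OF that]] by auto
  have Q: "set Q \<subseteq> permutations_of_set A"
    using perm' len unfolding set_conv_nth[of Q] by (auto simp: permutations_of_set_def)
  define near where "near i c \<longleftrightarrow> n_above (P ! i) a - n_above (P ! i) c \<le> \<kappa> i" for i c
  define y where "y = (\<lambda>(t, c). \<Sum>i | i < length P \<and> P ! i = t. of_bool (near i c) :: nat)"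
  have "(\<Sum>s\<in>slots A a. y s) = (\<Sum>i<length P. \<Sum>c | prefers (P ! i) c a. of_bool (near i c))"
    unfolding y_def by (rule sum_slots_by_vote[OF P])
  also have "\<dots> = (\<Sum>i<length P. min (\<kappa> i) (n_above (P ! i) a))"
  proof (intro sum.cong refl)
    fix i assume "i \<in> {..<length P}"
    thus "(\<Sum>c | prefers (P ! i) c a. of_bool (near i c)) = min (\<kappa> i) (n_above (P ! i) a)"
      using card_above_within[of "P ! i" a "\<kappa> i"] perm[of i] assms(2)
      by (simp add: near_def Int_def finite_above)
  qed
  also have "\<dots> \<le> (\<Sum>i<length P. \<kappa> i)"
    by (intro sum_mono) simp
  finally have "(\<Sum>s\<in>slots A a. y s) \<le> k" by (simp add: \<kappa>(1))
  moreover have "schedule A P a (margin P a) (\<lambda>s. of_nat (y s))"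
  proof -
    have "y (t, c) \<le> count (mset P) t" for t c
      unfolding y_def count_eq_sum prod.case by (intro sum_mono) simp
    moreover have "y (t, c) \<le> y (t, c')" if "(t, c') \<in> slots A a" "prefers t c c'" for t c c'
    proof -
      have "n_above t a - n_above t c' \<le> n_above t a - n_above t c"
        using that slots_voteD[OF that(1)] prefers_in_set[OF that(2)] prefers_iff_n_above[of t c c']
        by simp
      thus ?thesis
        unfolding y_def prod.case by (intro sum_mono) (auto simp: near_def)
    qed
    moreover have "margin P a b \<le> of_nat (\<Sum>t | (t, b) \<in> slots A a. y (t, b))"
      if b: "b \<in> A - {a}" for b
    proof -
      have "(\<Sum>t | (t, b) \<in> slots A a. y (t, b)) =
            (\<Sum>i | i < length P \<and> prefers (P ! i) b a. of_bool (near i b))"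
        unfolding y_def prod.case by (rule sum_by_vote[OF P])
      moreover have "n_prefer P b a \<le>
          n_prefer Q b a + (\<Sum>i | i < length P \<and> prefers (P ! i) b a. of_bool (near i b))"
      proof -
        have "near i b \<or> prefers (Q ! i) b a" if i: "i < length P" for i
        proof (cases "prefers (Q ! i) b a")
          case False
          have "n_above (P ! i) a - n_above (P ! i) b \<le>
                \<kappa> i + (n_above (Q ! i) a - n_above (Q ! i) b)"
            using perm[OF i] b assms(2) \<kappa>(2)[OF i]
            by (intro relpowp_vote_swap_n_above) auto
          moreover have "n_above (Q ! i) a \<le> n_above (Q ! i) b"
            using False perm'[OF i] b assms(2) by (simp add: prefers_iff_n_above)
          ultimately show ?thesis by (simp add: near_def)
        qed simp
        hence "{i. i < length P \<and> prefers (P ! i) b a} \<subseteq>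
            {i. i < length Q \<and> prefers (Q ! i) b a} \<union>
            {i. i < length P \<and> prefers (P ! i) b a \<and> near i b}"
          using len by auto
        from card_mono[OF _ this] show ?thesis
          unfolding n_prefer_def
          by (force intro: order_trans[OF _ card_Un_le] simp: Int_def conj_assoc)
      qed
      moreover have "n_prefer P a b + n_prefer P b a = n_prefer Q a b + n_prefer Q b a"
        using n_prefer_add[OF P, of a b] n_prefer_add[OF Q, of a b] b assms(2) len by auto
      moreover have "n_prefer Q b a \<le> n_prefer Q a b"
        using winner b unfolding condorcet_tie_winner_iff by blast
      ultimately have "n_prefer P b a \<le>
          n_prefer P a b + 2 * (\<Sum>t | (t, b) \<in> slots A a. y (t, b))"
        by linarith
      hence "(of_nat (n_prefer P b a) :: rat) \<le>
          of_nat (n_prefer P a b + 2 * (\<Sum>t | (t, b) \<in> slots A a. y (t, b)))"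
        by (rule of_nat_mono)
      thus ?thesis unfolding margin_def by simp
    qed
    ultimately show ?thesis unfolding schedule_def by auto
  qed
  ultimately show ?thesis by blast
qed

text \<open>
  Numbering the voters of each type makes it possible to hand out the raises of a schedule
  consistently: the first \<open>y (t, c)\<close> voters of type \<open>t\<close> raise \<open>a\<close> above \<open>c\<close>.
\<close>

lemma voter_ranking:
  "\<exists>r. \<forall>t. bij_betw r {i. i < length P \<and> P ! i = t} {..<count (mset P) t}"
proof -
  have "\<exists>h. bij_betw h {i. i < length P \<and> P ! i = t} {..<count (mset P) t}" for t
    using ex_bij_betw_finite_nat[of "{i. i < length P \<and> P ! i = t}"]
    by (simp add: count_eq_sum atLeast0LessThan)
  then obtain h where h: "\<And>t. bij_betw (h t) {i. i < length P \<and> P ! i = t} {..<count (mset P) t}"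
    by metis
  have "bij_betw (\<lambda>i. h (P ! i) i) {i. i < length P \<and> P ! i = t} {..<count (mset P) t}" for t
    using h[of t] by (rule iffD1[OF bij_betw_cong, rotated]) simp
  thus ?thesis by blast
qed

text \<open>
  An integral schedule is carried out by letting voter \<open>i\<close>, of number \<open>r i\<close> among the voters of
  the same type, raise \<open>a\<close> above those \<open>c\<close> with \<open>r i < y (P ! i, c)\<close>. By monotonicity of the
  schedule these form a block directly above \<open>a\<close>.
\<close>

lemma swaps_of_schedule:
  assumes P: "set P \<subseteq> permutations_of_set A" and "a \<in> A"
    and y: "schedule A P a (margin P a) (\<lambda>s. of_nat (y s))"
  shows "\<exists>Q. (neighbour_swap ^^ (\<Sum>s\<in>slots A a. y s)) P Q \<and> condorcet_tie_winner A Q a"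
proof -
  obtain r where r: "\<And>t. bij_betw r {i. i < length P \<and> P ! i = t} {..<count (mset P) t}"
    using voter_ranking by blast
  note perm = profile_nth[OF P]
  define U where "U i = {c. prefers (P ! i) c a \<and> r i < y (P ! i, c)}" for i
  have "\<exists>v. (vote_swap ^^ card (U i)) (P ! i) v \<and>
            (\<forall>c. prefers v c a \<longleftrightarrow> prefers (P ! i) c a \<and> c \<notin> U i)" if i: "i < length P" for i
  proof (rule vote_raise)
    fix c c' assume *: "c \<in> U i" "prefers (P ! i) c c'" "prefers (P ! i) c' a"
    hence "(P ! i, c') \<in> slots A a" using perm[OF i] by (simp add: slots_def)
    hence "y (P ! i, c) \<le> y (P ! i, c')"
      using y *(2) unfolding schedule_def by fastforce
    with * show "c' \<in> U i" by (simp add: U_def)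
  qed (use perm[OF i] assms(2) in \<open>auto simp: U_def\<close>)
  then obtain V where V: "\<And>i. i < length P \<Longrightarrow> (vote_swap ^^ card (U i)) (P ! i) (V i)"
    "\<And>i c. i < length P \<Longrightarrow> prefers (V i) c a \<longleftrightarrow> prefers (P ! i) c a \<and> c \<notin> U i"
    by metis
  define Q where "Q = map V [0..<length P]"
  have len: "length Q = length P" by (simp add: Q_def)
  have swaps: "(neighbour_swap ^^ (\<Sum>i<length P. card (U i))) P Q"
    unfolding relpowp_neighbour_swap_iff using V(1)
    by (auto simp: Q_def intro!: exI[of _ "\<lambda>i. card (U i)"])
  have Q: "set Q \<subseteq> permutations_of_set A"
    using perm relpowp_vote_swap_permutation[OF V(1)]
    by (auto simp: Q_def permutations_of_set_def)
  have rank_sum: "(\<Sum>i | i < length P \<and> P ! i = t. of_bool (r i < y (t, c))) = y (t, c)"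
    if "(t, c) \<in> slots A a" for t c
  proof -
    have "y (t, c) \<le> count (mset P) t"
      using y that unfolding schedule_def by fastforce
    hence "{..<count (mset P) t} \<inter> {l. l < y (t, c)} = {..<y (t, c)}" by auto
    thus ?thesis
      by (subst sum.reindex_bij_betw[OF r, of "\<lambda>l. of_bool (l < y (t, c))"]) simp
  qed
  have "(\<Sum>s\<in>slots A a. y s) =
      (\<Sum>(t, c)\<in>slots A a. \<Sum>i | i < length P \<and> P ! i = t. of_bool (r i < y (P ! i, c)))"
    using rank_sum by (intro sum.cong) auto
  also have "\<dots> = (\<Sum>i<length P. \<Sum>c | prefers (P ! i) c a. of_bool (r i < y (P ! i, c)))"
    by (rule sum_slots_by_vote[OF P])
  also have "\<dots> = (\<Sum>i<length P. card (U i))"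
    by (simp add: U_def finite_above Int_def)
  finally have "(neighbour_swap ^^ (\<Sum>s\<in>slots A a. y s)) P Q"
    using swaps by simp
  moreover have "n_prefer Q b a \<le> n_prefer Q a b" if b: "b \<in> A - {a}" for b
  proof -
    have "(\<Sum>t | (t, b) \<in> slots A a. y (t, b)) =
        (\<Sum>t | (t, b) \<in> slots A a. \<Sum>i | i < length P \<and> P ! i = t. of_bool (r i < y (P ! i, b)))"
      using rank_sum by (intro sum.cong) auto
    also have "\<dots> = (\<Sum>i | i < length P \<and> prefers (P ! i) b a. of_bool (r i < y (P ! i, b)))"
      by (rule sum_by_vote[OF P])
    also have "\<dots> = card {i. i < length P \<and> prefers (P ! i) b a \<and> b \<in> U i}"
      by (simp add: U_def Int_def conj_assoc)
    finally have "(\<Sum>t | (t, b) \<in> slots A a. y (t, b)) + n_prefer Q b a =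
        card ({i. i < length P \<and> prefers (P ! i) b a \<and> b \<in> U i} \<union>
              {i. i < length P \<and> prefers (Q ! i) b a})"
      unfolding n_prefer_def len
      by (subst card_Un_disjoint) (auto simp: Q_def V(2))
    also have "\<dots> = n_prefer P b a"
      unfolding n_prefer_def by (rule arg_cong[where f = card]) (auto simp: Q_def V(2))
    finally have "(\<Sum>t | (t, b) \<in> slots A a. y (t, b)) + n_prefer Q b a = n_prefer P b a" .
    moreover have "margin P a b \<le> of_nat (\<Sum>t | (t, b) \<in> slots A a. y (t, b))"
      using y b unfolding schedule_def by simp
    hence "(of_nat (n_prefer P b a) :: rat) \<le>
        of_nat (n_prefer P a b + 2 * (\<Sum>t | (t, b) \<in> slots A a. y (t, b)))"
      by (simp add: margin_def)
    hence "n_prefer P b a \<le> n_prefer P a b + 2 * (\<Sum>t | (t, b) \<in> slots A a. y (t, b))"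
      by (simp only: of_nat_le_iff)
    moreover have "n_prefer P a b + n_prefer P b a = n_prefer Q a b + n_prefer Q b a"
      using n_prefer_add[OF P, of a b] n_prefer_add[OF Q, of a b] b assms(2) len by auto
    ultimately show ?thesis by linarith
  qed
  ultimately show ?thesis unfolding condorcet_tie_winner_iff by blast
qed

lemma dodgson_score_le:
  assumes "set P \<subseteq> permutations_of_set A" "a \<in> A"
    and "schedule A P a (margin P a) (\<lambda>s. of_nat (y s))"
  shows "dodgson_score A P a \<le> (\<Sum>s\<in>slots A a. y s)"
  unfolding dodgson_score_def using swaps_of_schedule[OF assms] by (rule Least_le)

text \<open>
  Moving \<open>a\<close> to the top of every vote meets all demands that can be met at all, which makes the
  integer and linear programs feasible.
\<close>

lemma schedule_full:
  assumes "set P \<subseteq> permutations_of_set A" "\<And>b. b \<in> A - {a} \<Longrightarrow> d b \<le> of_nat (n_prefer P b a)"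
  shows "schedule A P a d (\<lambda>s. of_nat (count (mset P) (fst s)))"
  using assms(2) sum_count_above[OF assms(1), of _ a, symmetric]
  by (auto simp: schedule_def)

lemma dodgson_swaps:
  assumes "set P \<subseteq> permutations_of_set A" "a \<in> A"
  shows "\<exists>Q. (neighbour_swap ^^ dodgson_score A P a) P Q \<and> condorcet_tie_winner A Q a"
  unfolding dodgson_score_def
proof (rule LeastI_ex)
  have "schedule A P a (margin P a) (\<lambda>s. of_nat (count (mset P) (fst s)))"
    by (intro schedule_full margin_le_n_prefer assms)
  from swaps_of_schedule[OF assms this]
  show "\<exists>k Q. (neighbour_swap ^^ k) P Q \<and> condorcet_tie_winner A Q a" by blast
qed

lemma dodgson_schedule:
  assumes "set P \<subseteq> permutations_of_set A" "a \<in> A"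
  shows "\<exists>y. schedule A P a (margin P a) (\<lambda>s. of_nat (y s)) \<and>
             (\<Sum>s\<in>slots A a. y s) = dodgson_score A P a"
proof -
  obtain y where "schedule A P a (margin P a) (\<lambda>s. of_nat (y s))"
    "(\<Sum>s\<in>slots A a. y s) \<le> dodgson_score A P a"
    using dodgson_swaps[OF assms] schedule_of_swaps[OF assms] by blast
  with dodgson_score_le[OF assms] show ?thesis by (metis order_antisym)
qed

section \<open>Scores of two alternatives are rarely close\<close>

text \<open>
  The properties of a score that force the scores of two alternatives apart in most voting
  situations. The last one is the essential one: moving \<open>a\<close> in one vote from the bottom to the
  top, however the other alternatives are rearranged, lowers the score of \<open>a\<close> by at least 1
  unless it is 0 already. The subtraction in it is truncated.
\<close>

locale steep_score =
  fixes A :: "'a set" and score :: "'a profile \<Rightarrow> 'a \<Rightarrow> nat"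
  assumes mset_cong: "\<lbrakk>set P \<subseteq> permutations_of_set A; a \<in> A; mset P = mset Q\<rbrakk> \<Longrightarrow>
      score P a = score Q a"
    and tie_winner: "\<lbrakk>set P \<subseteq> permutations_of_set A; a \<in> A; score P a = 0\<rbrakk> \<Longrightarrow>
      condorcet_tie_winner A P a"
    and promotion: "\<lbrakk>set P \<subseteq> permutations_of_set A; a \<in> A;
      v \<in> permutations_of_set A; \<And>c. c \<in> A - {a} \<Longrightarrow> prefers v c a;
      v' \<in> permutations_of_set A; \<And>c. c \<in> A - {a} \<Longrightarrow> prefers v' a c\<rbrakk> \<Longrightarrow>
      score (v' # P) a \<le> score (v # P) a - 1"

text \<open>
  Such a promotion of \<open>a\<close> changes every pairwise majority against \<open>a\<close> by 2, so every positive
  \<open>adv (b, a)\<close> drops by at least 1.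
\<close>

lemma steep_score_tideman:
  assumes "finite A"
  shows "steep_score A (\<lambda>P a. nat (tideman_score A P a))"
proof
  fix P Q :: "'a profile" and a assume "mset P = mset Q"
  thus "nat (tideman_score A P a) = nat (tideman_score A Q a)"
    by (simp add: tideman_score_def adv_def n_prefer_mset_cong[of P Q])
next
  fix P :: "'a profile" and a assume "nat (tideman_score A P a) = 0"
  moreover have nonneg: "adv P b a \<ge> 0" for b by (simp add: adv_def)
  ultimately have "(\<Sum>b\<in>A - {a}. adv P b a) = 0"
    using sum_nonneg[of "A - {a}" "\<lambda>b. adv P b a"] by (simp add: tideman_score_def)
  thus "condorcet_tie_winner A P a"
    using assms nonneg unfolding condorcet_tie_winner_def
    by (subst (asm) sum_nonneg_eq_0_iff) auto
next
  fix P :: "'a profile" and a v v'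
  assume v: "v \<in> permutations_of_set A" "\<And>c. c \<in> A - {a} \<Longrightarrow> prefers v c a"
    and v': "v' \<in> permutations_of_set A" "\<And>c. c \<in> A - {a} \<Longrightarrow> prefers v' a c"
  have nonneg: "adv Q b a \<ge> 0" for Q b by (simp add: adv_def)
  have le: "adv (v' # P) b a \<le> max 0 (adv (v # P) b a - 1)" if "b \<in> A - {a}" for b
    using v(2)[OF that] v'(2)[OF that] v(1) v'(1)
      prefers_asym[of v b a] prefers_asym[of v' a b]
    by (auto simp: adv_def n_prefer_Cons permutations_of_set_def)
  show "nat (tideman_score A (v' # P) a) \<le> nat (tideman_score A (v # P) a) - 1"
  proof (cases "\<exists>b\<in>A - {a}. adv (v # P) b a > 0")
    case True
    then obtain b where b: "b \<in> A - {a}" "adv (v # P) b a > 0" by blast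
    have "tideman_score A (v' # P) a < tideman_score A (v # P) a"
      unfolding tideman_score_def
    proof (rule sum_strict_mono_ex1)
      show "\<forall>c\<in>A - {a}. adv (v' # P) c a \<le> adv (v # P) c a"
        using le nonneg[of "v # P"] by (smt (verit))
      show "\<exists>c\<in>A - {a}. adv (v' # P) c a < adv (v # P) c a"
        using le[OF b(1)] b by (intro bexI[of _ b]) auto
    qed (use assms in auto)
    thus ?thesis by linarith
  next
    case False
    hence "tideman_score A (v' # P) a \<le> 0"
      unfolding tideman_score_def using le by (intro sum_nonpos) (smt (verit))
    thus ?thesis by simp
  qed
qed

text \<open>
  Promoting \<open>a\<close> from the bottom of \<open>v\<close> to the top of \<open>v'\<close> lowers all demands by 1, so an optimal
  schedule for the old profile may give up the raises in one voter of some type \<open>t0\<close>; this loses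
  at most 1 towards each demand and saves at least 1 in cost, unless the cost is 0. The type has
  to be chosen so that the result also respects that there is one voter of type \<open>v\<close> less: it is
  \<open>v\<close> itself if the schedule uses \<open>v\<close> at all.
\<close>

lemma steep_score_dodgson: "steep_score A (dodgson_score A)"
proof
  fix P Q :: "'a profile" and a
  assume P: "set P \<subseteq> permutations_of_set A" "a \<in> A" and PQ: "mset P = mset Q"
  hence Q: "set Q \<subseteq> permutations_of_set A" by (metis set_mset_mset)
  obtain y where y: "schedule A P a (margin P a) (\<lambda>s. of_nat (y s))"
    "(\<Sum>s\<in>slots A a. y s) = dodgson_score A P a"
    using dodgson_schedule[OF P] by blast
  obtain z where z: "schedule A Q a (margin Q a) (\<lambda>s. of_nat (z s))"
    "(\<Sum>s\<in>slots A a. z s) = dodgson_score A Q a"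
    using dodgson_schedule[OF Q P(2)] by blast
  show "dodgson_score A P a = dodgson_score A Q a"
    using dodgson_score_le[OF P, of z] dodgson_score_le[OF Q P(2), of y] y z
    by (simp add: margin_mset_cong[OF PQ] schedule_mset_cong[OF PQ])
next
  fix P :: "'a profile" and a
  assume "set P \<subseteq> permutations_of_set A" "a \<in> A" "dodgson_score A P a = 0"
  with dodgson_swaps[of P A a] show "condorcet_tie_winner A P a" by simp
next
  fix P :: "'a profile" and a v v'
  assume P: "set P \<subseteq> permutations_of_set A" and a: "a \<in> A"
    and v: "v \<in> permutations_of_set A" "\<And>c. c \<in> A - {a} \<Longrightarrow> prefers v c a"
    and v': "v' \<in> permutations_of_set A" "\<And>c. c \<in> A - {a} \<Longrightarrow> prefers v' a c"
  have vP: "set (v # P) \<subseteq> permutations_of_set A" "set (v' # P) \<subseteq> permutations_of_set A"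
    using P v(1) v'(1) by auto
  obtain y where y: "schedule A (v # P) a (margin (v # P) a) (\<lambda>s. of_nat (y s))"
    and cost: "(\<Sum>s\<in>slots A a. y s) = dodgson_score A (v # P) a"
    using dodgson_schedule[OF vP(1) a] by blast
  have y_count: "y (t, c) \<le> count (mset (v # P)) t" if "(t, c) \<in> slots A a" for t c
    using y that unfolding schedule_def by fastforce
  have y_mono: "y (t, c) \<le> y (t, c')" if "(t, c') \<in> slots A a" "prefers t c c'" for t c c'
    using y that unfolding schedule_def by fastforce
  have y_demand: "margin (v # P) a b \<le> of_nat (\<Sum>t | (t, b) \<in> slots A a. y (t, b))"
    if "b \<in> A - {a}" for b
    using y that unfolding schedule_def by simp
  define t0 where "t0 = (if \<exists>c. (v, c) \<in> slots A a \<and> y (v, c) > 0 then v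
                         else SOME t. \<exists>c. (t, c) \<in> slots A a \<and> y (t, c) > 0)"
  have t0: "\<exists>c. (t0, c) \<in> slots A a \<and> y (t0, c) > 0"
    if "\<exists>t c. (t, c) \<in> slots A a \<and> y (t, c) > 0"
    unfolding t0_def using someI_ex[OF that] by auto
  \<comment> \<open>The subtraction is truncated: one voter of type \<open>t0\<close> no longer moves \<open>a\<close>, while the
    slots of that type that were unused stay at 0.\<close>
  define z where "z = (\<lambda>(t, c). y (t, c) - of_bool (t = t0))"
  have "schedule A (v' # P) a (margin (v' # P) a) (\<lambda>s. of_nat (z s))"
  proof -
    have "z (t, c) \<le> count (mset (v' # P)) t" if tc: "(t, c) \<in> slots A a" for t c
    proof (cases "t = v")
      case True
      have "t0 = v \<or> y (v, c) = 0" using tc True by (auto simp: t0_def)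
      with y_count[OF tc] True show ?thesis by (auto simp: z_def)
    next
      case False
      with y_count[OF tc] show ?thesis by (auto simp: z_def)
    qed
    moreover have "z (t, c) \<le> z (t, c')" if "(t, c') \<in> slots A a" "prefers t c c'" for t c c'
      using y_mono[OF that] by (simp add: z_def diff_le_mono)
    moreover have "margin (v' # P) a b \<le> of_nat (\<Sum>t | (t, b) \<in> slots A a. z (t, b))"
      if b: "b \<in> A - {a}" for b
    proof -
      have "margin (v' # P) a b = margin (v # P) a b - 1"
        using v(2)[OF b] v'(2)[OF b] v(1) v'(1) prefers_asym[of v b a] prefers_asym[of v' a b]
        by (simp add: margin_def n_prefer_Cons permutations_of_set_def field_simps)
      moreover have "(\<Sum>t | (t, b) \<in> slots A a. y (t, b)) \<le>
          (\<Sum>t | (t, b) \<in> slots A a. z (t, b) + of_bool (t = t0))"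
        by (intro sum_mono) (auto simp: z_def)
      moreover have "(\<Sum>t | (t, b) \<in> slots A a. of_bool (t = t0)) \<le> (1 :: nat)"
        using finite_slots_above[of b A a] card_mono[of "{t0}" "{t. (t, b) \<in> slots A a} \<inter> {t. t = t0}"]
        by auto
      ultimately have "(\<Sum>t | (t, b) \<in> slots A a. y (t, b)) \<le> (\<Sum>t | (t, b) \<in> slots A a. z (t, b)) + 1"
        by (simp add: sum.distrib)
      hence "(of_nat (\<Sum>t | (t, b) \<in> slots A a. y (t, b)) :: rat) \<le>
          of_nat ((\<Sum>t | (t, b) \<in> slots A a. z (t, b)) + 1)"
        by (rule of_nat_mono)
      with y_demand[OF b] \<open>margin (v' # P) a b = margin (v # P) a b - 1\<close> show ?thesis
        by simp
    qed
    ultimately show ?thesis unfolding schedule_def by auto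
  qed
  hence "dodgson_score A (v' # P) a \<le> (\<Sum>s\<in>slots A a. z s)"
    by (rule dodgson_score_le[OF vP(2) a])
  also have "\<dots> \<le> (\<Sum>s\<in>slots A a. y s) - 1"
  proof (cases "\<exists>t c. (t, c) \<in> slots A a \<and> y (t, c) > 0")
    case True
    from t0[OF this] obtain c where c: "(t0, c) \<in> slots A a" "y (t0, c) > 0" by blast
    have "(\<Sum>s\<in>slots A a. z s) < (\<Sum>s\<in>slots A a. y s)"
    proof (rule sum_strict_mono_ex1[OF finite_slots])
      show "\<exists>s\<in>slots A a. z s < y s"
        using c by (intro bexI[of _ "(t0, c)"]) (auto simp: z_def)
    qed (auto simp: z_def)
    thus ?thesis by simp
  next
    case False
    hence "(\<Sum>s\<in>slots A a. z s) = 0" by (intro sum.neutral) (auto simp: z_def)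
    thus ?thesis by simp
  qed
  finally show "dodgson_score A (v' # P) a \<le> dodgson_score A (v # P) a - 1"
    by (simp add: cost)
qed

lemma extreme_vote:
  assumes "finite A" "a \<in> A" "b \<in> A" "a \<noteq> b"
  shows "\<exists>u. b # u @ [a] \<in> permutations_of_set A \<and> a # u @ [b] \<in> permutations_of_set A"
proof -
  obtain u where "set u = A - {a, b}" "distinct u"
    using finite_distinct_list[of "A - {a, b}"] assms(1) by auto
  with assms show ?thesis
    by (intro exI[of _ u]) (auto simp: permutations_of_set_def)
qed

context steep_score
begin

text \<open>
  The difference of two scores as a function of the voting situation. Any profile with that
  situation may be chosen, because the scores do not depend on the order of the votes.
\<close>

definition gap :: "'a \<Rightarrow> 'a \<Rightarrow> 'a vote multiset \<Rightarrow> int" where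
  "gap a b V = (let P = SOME P. mset P = V in int (score P a) - int (score P b))"

lemma gap_mset:
  assumes "set P \<subseteq> permutations_of_set A" "a \<in> A" "b \<in> A"
  shows "gap a b (mset P) = int (score P a) - int (score P b)"
proof -
  define Q where "Q = (SOME Q. mset Q = mset P)"
  have "mset Q = mset P" unfolding Q_def by (rule someI) (rule refl)
  thus ?thesis
    using mset_cong[OF assms(1,2), of Q] mset_cong[OF assms(1,3), of Q]
    by (simp add: gap_def Q_def Let_def)
qed

text \<open>
  Exchanging \<open>b\<close> at the top with \<open>a\<close> at the bottom of one vote promotes \<open>a\<close>, and the reverse
  exchange promotes \<open>b\<close>. So the score of \<open>a\<close> falls or stays 0, and that of \<open>b\<close> rises or stays 0.
  They cannot both stay 0: then \<open>a\<close> and \<open>b\<close> would be Condorcet-tie winners, hence tied with each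
  other, before and after the exchange, which changes the majority between them.
\<close>

lemma gap_swap_extremes:
  assumes R: "set_mset R \<subseteq> permutations_of_set A" and ab: "a \<in> A" "b \<in> A" "a \<noteq> b"
    and v: "b # u @ [a] \<in> permutations_of_set A" "a # u @ [b] \<in> permutations_of_set A"
  shows "gap a b (add_mset (a # u @ [b]) R) < gap a b (add_mset (b # u @ [a]) R)"
proof -
  define v v' where "v = b # u @ [a]" and "v' = a # u @ [b]"
  obtain P where P: "mset P = R" using ex_mset by blast
  hence setP: "set P \<subseteq> permutations_of_set A" using R by (metis set_mset_mset)
  have A: "A = set u \<union> {a, b}" and u: "a \<notin> set u" "b \<notin> set u"
    using v by (auto simp: permutations_of_set_def)
  have vP: "set (v # P) \<subseteq> permutations_of_set A" "set (v' # P) \<subseteq> permutations_of_set A"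
    using setP v by (auto simp: v_def v'_def)
  have ext: "prefers v c a" "prefers v' a c" if "c \<in> A - {a}" for c
    using that by (auto simp: v_def v'_def A)
  have ext': "prefers v' c b" "prefers v b c" if "c \<in> A - {b}" for c
    using that by (auto simp: v_def v'_def A)
  have down: "score (v' # P) a \<le> score (v # P) a - 1"
    using setP ab v ext by (intro promotion) (auto simp: v_def v'_def)
  have up: "score (v # P) b \<le> score (v' # P) b - 1"
    using setP ab v ext' by (intro promotion) (auto simp: v_def v'_def)
  have "score (v # P) a > 0 \<or> score (v' # P) b > 0"
  proof (rule ccontr)
    assume "\<not> (score (v # P) a > 0 \<or> score (v' # P) b > 0)"
    with down up have "score (v # P) a = 0" "score (v' # P) a = 0"
      "score (v # P) b = 0" "score (v' # P) b = 0" by auto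
    hence "condorcet_tie_winner A (v # P) a" "condorcet_tie_winner A (v' # P) a"
      "condorcet_tie_winner A (v # P) b" "condorcet_tie_winner A (v' # P) b"
      using vP ab tie_winner by auto
    hence "n_prefer (v # P) a b = n_prefer (v # P) b a" "n_prefer (v' # P) a b = n_prefer (v' # P) b a"
      using ab unfolding condorcet_tie_winner_iff by (auto intro: order_antisym)
    moreover have "prefers v b a" "\<not> prefers v a b" "prefers v' a b" "\<not> prefers v' b a"
      using u ab prefers_in_set[of u] by (auto simp: v_def v'_def)
    ultimately show False by (simp add: n_prefer_Cons)
  qed
  with down up have "int (score (v' # P) a) - int (score (v' # P) b) <
      int (score (v # P) a) - int (score (v # P) b)" by auto
  thus ?thesis
    using gap_mset[OF vP(1) ab(1,2)] gap_mset[OF vP(2) ab(1,2)] by (simp add: P v_def v'_def)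
qed

lemma gap_swap_many:
  assumes ab: "a \<in> A" "b \<in> A" "a \<noteq> b"
    and v: "b # u @ [a] \<in> permutations_of_set A" "a # u @ [b] \<in> permutations_of_set A"
    and "k > 0" "set_mset R \<subseteq> permutations_of_set A"
  shows "gap a b (R + replicate_mset k (a # u @ [b])) < gap a b (R + replicate_mset k (b # u @ [a]))"
  using assms(6,7)
proof (induction k arbitrary: R rule: nat_induct_non_zero)
  case 1
  thus ?case using gap_swap_extremes[OF _ ab v, of R] by simp
next
  case (Suc k)
  have "gap a b (R + replicate_mset (Suc k) (a # u @ [b])) <
        gap a b (add_mset (b # u @ [a]) R + replicate_mset k (a # u @ [b]))"
    using gap_swap_extremes[OF _ ab v, of "R + replicate_mset k (a # u @ [b])"] Suc.prems v
    by (auto dest: in_replicate_mset[THEN iffD1] split: if_splits)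
  also have "\<dots> < gap a b (add_mset (b # u @ [a]) R + replicate_mset k (b # u @ [a]))"
    using Suc.prems v by (intro Suc.IH) auto
  finally show ?case by simp
qed

text \<open>
  Merging the vote type \<open>v\<close> into \<open>v'\<close> sends a voting situation to one over the remaining types.
  The situations with the same image lie on a chain, ordered by their number of votes \<open>v\<close>, along
  which the gap is strictly monotone. So the gap is injective on each chain, and at most
  \<open>2 * K + 1\<close> members of it have a gap of absolute value at most \<open>K\<close>.
\<close>

lemma card_close_scores:
  assumes "finite A" and ab: "a \<in> A" "b \<in> A" "a \<noteq> b"
  shows "card {V \<in> voting_situations A n. \<bar>gap a b V\<bar> \<le> int K} \<le>
           (2 * K + 1) * (card (permutations_of_set A) + n - 2 choose n)"
proof -
  let ?T = "permutations_of_set A"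
  obtain u where u: "b # u @ [a] \<in> ?T" "a # u @ [b] \<in> ?T"
    using extreme_vote[OF assms] by blast
  define v v' where "v = b # u @ [a]" and "v' = a # u @ [b]"
  have vv': "v \<in> ?T" "v' \<in> ?T" "v \<noteq> v'" using u ab by (auto simp: v_def v'_def)
  define rest where "rest V = filter_mset (\<lambda>t. t \<noteq> v) V" for V :: "'a vote multiset"
  define merge where "merge V = rest V + replicate_mset (count V v) v'" for V
  have split: "V = rest V + replicate_mset (count V v) v" for V
    by (auto simp: rest_def multiset_eq_iff)
  have less: "gap a b V < gap a b V'"
    if "merge V = merge V'" "count V v < count V' v" "set_mset V' \<subseteq> ?T" for V V'
  proof -
    define k R where "k = count V' v - count V v" and "R = rest V' + replicate_mset (count V v) v"
    have k: "count V' v = count V v + k" "k > 0" using that by (auto simp: k_def)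
    have rest: "rest V = rest V' + replicate_mset k v'"
    proof (rule multiset_eqI)
      fix t
      have "count (merge V) t = count (merge V') t" using that(1) by simp
      thus "count (rest V) t = count (rest V' + replicate_mset k v') t"
        by (auto simp: merge_def k(1) split: if_splits)
    qed
    have "V = R + replicate_mset k v'"
      by (subst split, subst rest) (simp add: R_def ac_simps)
    moreover have "V' = R + replicate_mset k v"
      by (subst split, subst k) (simp add: R_def multiset_eq_iff)
    moreover have "set_mset R \<subseteq> ?T"
      using that(3) vv'(1) by (auto simp: R_def rest_def split: if_splits)
    ultimately show ?thesis
      using gap_swap_many[OF ab u k(2), of R] by (simp add: v_def v'_def)
  qed
  let ?B = "{V \<in> voting_situations A n. \<bar>gap a b V\<bar> \<le> int K}"
  let ?C = "multisets_of_size (?T - {v}) n"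
  have "inj_on (\<lambda>V. (merge V, gap a b V)) ?B"
  proof (rule inj_onI)
    fix V V' assume V: "V \<in> ?B" "V' \<in> ?B" and eq: "(merge V, gap a b V) = (merge V', gap a b V')"
    have "count V v = count V' v"
      using less[of V V'] less[of V' V] V eq
      by (cases "count V v" "count V' v" rule: linorder_cases)
         (auto simp: voting_situations_def multisets_of_size_def)
    moreover from this eq have "rest V = rest V'" by (simp add: merge_def)
    ultimately show "V = V'" using split[of V] split[of V'] by simp
  qed
  moreover have "(\<lambda>V. (merge V, gap a b V)) ` ?B \<subseteq> ?C \<times> {- int K..int K}"
  proof safe
    fix V assume V: "V \<in> voting_situations A n" "\<bar>gap a b V\<bar> \<le> int K"
    show "gap a b V \<in> {- int K..int K}" using V(2) by auto
    have "size (merge V) = size V"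
      using arg_cong[OF split[of V], of size] by (simp add: merge_def)
    moreover have "set_mset (merge V) \<subseteq> ?T - {v}"
      using V(1) vv' by (auto simp: merge_def rest_def voting_situations_def multisets_of_size_def
          split: if_splits)
    ultimately show "merge V \<in> ?C"
      using V(1) by (simp add: voting_situations_def multisets_of_size_def)
  qed
  moreover have "finite (?C \<times> {- int K..int K})" by (auto intro!: finite_multisets_of_size)
  ultimately have "card ?B \<le> card (?C \<times> {- int K..int K})" by (rule card_inj_on_le)
  also have "\<dots> = (2 * K + 1) * (card ?T + n - 2 choose n)"
  proof -
    have "card {- int K..int K} = 2 * K + 1" by simp
    moreover have "card ?T > 0" using assms(1) by simp
    hence "card (?T - {v}) + n - 1 = card ?T + n - 2"
      using vv'(1) by (simp add: card_Diff_singleton)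
    ultimately show ?thesis
      by (simp add: card_multisets_of_size card_cartesian_product mult.commute)
  qed
  finally show ?thesis .
qed

text \<open>
  With \<open>N\<close> vote types there are \<open>N + n - 1 choose n\<close> situations. Multisets of size \<open>n\<close> over
  \<open>N - 1\<close> types are fewer by the factor \<open>(N - 1) / (N + n - 1)\<close>, which tends to 0. By the
  preceding count, so does the proportion of situations in which two of the finitely many
  alternatives have scores within \<open>K\<close>.
\<close>

lemma almost_all_situations:
  assumes "finite A"
    and E: "\<And>P. \<lbrakk>set P \<subseteq> permutations_of_set A;
      \<And>a b. \<lbrakk>a \<in> A; b \<in> A; a \<noteq> b\<rbrakk> \<Longrightarrow> int K < \<bar>int (score P a) - int (score P b)\<bar>\<rbrakk> \<Longrightarrow> E P"
  shows "(\<lambda>n. measure_pmf.prob (IAC A n) (situation_event E)) \<longlonglongrightarrow> 1"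
proof -
  let ?T = "permutations_of_set A"
  define N where "N = card ?T"
  define c where "c = card (A \<times> A) * (2 * K + 1)"
  have N: "N > 0" using assms(1) by (simp add: N_def)
  have bound: "1 - real c * real (N - 1) / real (N + n - 1) \<le>
      measure_pmf.prob (IAC A n) (situation_event E)" if "n > 0" for n
  proof -
    let ?V = "voting_situations A n"
    define D where "D = {(a, b) \<in> A \<times> A. a \<noteq> b}"
    have "D \<subseteq> A \<times> A" by (auto simp: D_def)
    with assms(1) have D: "finite D" "card D \<le> card (A \<times> A)"
      using finite_subset[of D "A \<times> A"] card_mono[of "A \<times> A" D] by blast+
    define B where "B = (\<lambda>(a, b). {V \<in> ?V. \<bar>gap a b V\<bar> \<le> int K})"
    have cardV: "card ?V = N + n - 1 choose n"
      by (simp add: voting_situations_def card_multisets_of_size N_def)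
    have finV: "finite ?V" unfolding voting_situations_def by (rule finite_multisets_of_size) simp
    have "card ?V > 0" using N by (simp add: cardV)
    hence V: "card ?V > 0" "?V \<noteq> {}" by auto
    have "?V - situation_event E \<subseteq> (\<Union>p\<in>D. B p)"
    proof
      fix V assume "V \<in> ?V - situation_event E"
      then obtain P where P: "V \<in> ?V" "mset P = V" "\<not> E P"
        by (auto simp: situation_event_def)
      hence "set P \<subseteq> ?T" by (auto simp: voting_situations_def multisets_of_size_def)
      with E[of P] P(3) obtain a b where "a \<in> A" "b \<in> A" "a \<noteq> b"
        "\<bar>int (score P a) - int (score P b)\<bar> \<le> int K" by force
      with P gap_mset[of P a b] \<open>set P \<subseteq> ?T\<close> have "V \<in> B (a, b)" by (simp add: B_def)
      with \<open>a \<in> A\<close> \<open>b \<in> A\<close> \<open>a \<noteq> b\<close> show "V \<in> (\<Union>p\<in>D. B p)" by (auto simp: D_def)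
    qed
    hence "card (?V - situation_event E) \<le> card (\<Union>p\<in>D. B p)"
      using D(1) finV by (intro card_mono finite_UN_I) (auto simp: B_def)
    also have "\<dots> \<le> (\<Sum>p\<in>D. card (B p))"
      by (rule card_UN_le[OF D(1)])
    also have "\<dots> \<le> (\<Sum>p\<in>D. (2 * K + 1) * (N + n - 2 choose n))"
      using card_close_scores[OF assms(1)] by (intro sum_mono) (auto simp: B_def D_def N_def)
    also have "\<dots> \<le> card (A \<times> A) * ((2 * K + 1) * (N + n - 2 choose n))"
      using mult_right_mono[OF D(2), of "(2 * K + 1) * (N + n - 2 choose n)"] by simp
    finally have "card (?V - situation_event E) \<le> c * (N + n - 2 choose n)"
      by (simp only: c_def mult.assoc)
    hence "real (card (?V - situation_event E)) \<le> real (c * (N + n - 2 choose n))"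
      by (rule of_nat_mono)
    moreover have "real (N + n - 2 choose n) = real (N - 1) / real (N + n - 1) * real (card ?V)"
    proof -
      have "(N + n - 1 - n) * (N + n - 1 choose n) = (N + n - 1) * (N + n - 1 - 1 choose n)"
        by (rule binomial_absorb_comp)
      hence "(N - 1) * card ?V = (N + n - 1) * (N + n - 2 choose n)"
        by (simp add: cardV numeral_2_eq_2)
      hence "real (N - 1) * real (card ?V) = real (N + n - 1) * real (N + n - 2 choose n)"
        by (metis of_nat_mult)
      thus ?thesis using N that by (simp add: field_simps)
    qed
    ultimately have "real (card (?V - situation_event E)) / real (card ?V) \<le>
        real c * real (N - 1) / real (N + n - 1)"
      using V(1) by (simp add: divide_le_eq)
    moreover have "real (card (?V \<inter> situation_event E)) =
        real (card ?V) - real (card (?V - situation_event E))"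
      using finV card_Diff_subset_Int[of ?V "situation_event E"] card_mono[OF finV, of "?V \<inter> situation_event E"]
      by simp
    ultimately show ?thesis
      using V by (simp add: IAC_def measure_pmf_of_set[OF V(2) finV] diff_divide_distrib)
  qed
  show ?thesis
  proof (rule tendsto_sandwich)
    show "(\<lambda>n. 1 - real c * real (N - 1) / real (N + n - 1)) \<longlonglongrightarrow> 1"
      by real_asymp
    show "\<forall>\<^sub>F n in sequentially. 1 - real c * real (N - 1) / real (N + n - 1) \<le>
        measure_pmf.prob (IAC A n) (situation_event E)"
      using eventually_gt_at_top[of 0] by eventually_elim (rule bound)
    show "\<forall>\<^sub>F n in sequentially. measure_pmf.prob (IAC A n) (situation_event E) \<le> 1"
      by simp
    show "(\<lambda>_. 1 :: real) \<longlonglongrightarrow> 1" by simp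
  qed
qed

end

section \<open>Linear relaxations of the Dodgson score\<close>

text \<open>
  Each of the four families of conditions on a schedule is a finite family of weak linear
  inequalities.
\<close>

lemma polyhedral_schedule:
  assumes "finite A"
  shows "polyhedral (slots A a) (schedule A P a d)"
proof -
  let ?W = "slots A a"
  have coord: "(\<Sum>v\<in>?W. of_bool (v = s) * z v) = z s" if "s \<in> ?W" for s and z :: "_ \<Rightarrow> rat"
  proof -
    have "(\<Sum>v\<in>?W. of_bool (v = s) * z v) = (\<Sum>v\<in>?W. if v = s then z v else 0)"
      by (intro sum.cong) auto
    thus ?thesis using that by (simp add: finite_slots)
  qed
  have 1: "polyhedral ?W (\<lambda>z. \<forall>(t, c)\<in>?W. 0 \<le> z (t, c))"
    by (rule polyhedral_halfspaces[where f = "\<lambda>s v. - of_bool (v = s)" and \<beta> = "\<lambda>_. 0"])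
       (auto simp: finite_slots sum_negf coord)
  have 2: "polyhedral ?W (\<lambda>z. \<forall>(t, c)\<in>?W. z (t, c) \<le> of_nat (count (mset P) t))"
    by (rule polyhedral_halfspaces[where f = "\<lambda>s v. of_bool (v = s)"
          and \<beta> = "\<lambda>s. of_nat (count (mset P) (fst s))"])
       (auto simp: finite_slots coord)
  have 3: "polyhedral ?W (\<lambda>z. \<forall>(t, c, c')\<in>{(t, c, c'). (t, c') \<in> ?W \<and> prefers t c c'}. z (t, c) \<le> z (t, c'))"
  proof (rule polyhedral_halfspaces[where f = "\<lambda>(t, c, c') v. of_bool (v = (t, c)) - of_bool (v = (t, c'))"
          and \<beta> = "\<lambda>_. 0"])
    have "{(t, c, c'). (t, c') \<in> ?W \<and> prefers t c c'} \<subseteq> permutations_of_set A \<times> A \<times> A"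
      by (auto dest: slots_voteD(1,5) slots_voteD(5)[OF slots_upward])
    thus "finite {(t, c, c'). (t, c') \<in> ?W \<and> prefers t c c'}"
      by (rule finite_subset) (use assms in simp)
    fix i and z :: "'a vote \<times> 'a \<Rightarrow> rat"
    assume "i \<in> {(t, c, c'). (t, c') \<in> ?W \<and> prefers t c c'}"
    then obtain t c c' where i: "i = (t, c, c')" "(t, c') \<in> ?W" "prefers t c c'" by blast
    moreover have "(t, c) \<in> ?W"
      using i(2,3) by (rule slots_upward)
    ultimately show "(case i of (t, c, c') \<Rightarrow> z (t, c) \<le> z (t, c')) =
      ((\<Sum>v\<in>?W. (case i of (t, c, c') \<Rightarrow> \<lambda>v. of_bool (v = (t, c)) - of_bool (v = (t, c'))) v * z v) \<le> 0)"
      by (simp add: left_diff_distrib sum_subtractf coord)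
  qed
  have 4: "polyhedral ?W (\<lambda>z. \<forall>b\<in>A - {a}. d b \<le> (\<Sum>t | (t, b) \<in> ?W. z (t, b)))"
  proof (rule polyhedral_halfspaces[where f = "\<lambda>b v. - of_bool (snd v = b)" and \<beta> = "\<lambda>b. - d b"])
    fix b and z :: "'a vote \<times> 'a \<Rightarrow> rat"
    have "(\<Sum>v\<in>?W. of_bool (snd v = b) * z v) = (\<Sum>v\<in>{v \<in> ?W. snd v = b}. z v)"
      unfolding sum.inter_filter[OF finite_slots] by (intro sum.cong) auto
    also have "\<dots> = (\<Sum>t | (t, b) \<in> ?W. z (t, b))"
      by (rule sum.reindex_bij_witness[where i = "\<lambda>t. (t, b)" and j = fst]) auto
    finally show "(d b \<le> (\<Sum>t | (t, b) \<in> ?W. z (t, b))) =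
        ((\<Sum>v\<in>?W. - of_bool (snd v = b) * z v) \<le> - d b)"
      by (simp add: sum_negf)
  qed (use assms in simp)
  show ?thesis
    unfolding schedule_def by (intro polyhedral_conj 1 2 3 4)
qed

definition schedule_optimum :: "'a set \<Rightarrow> 'a profile \<Rightarrow> 'a \<Rightarrow> ('a \<Rightarrow> rat) \<Rightarrow> rat \<Rightarrow> bool" where
  "schedule_optimum A P a d q \<longleftrightarrow>
     (\<exists>y. schedule A P a d y \<and> q = (\<Sum>s\<in>slots A a. y s)) \<and>
     (\<forall>y. schedule A P a d y \<longrightarrow> q \<le> (\<Sum>s\<in>slots A a. y s))"

lemma schedule_optimum_exists:
  assumes "finite A" "set P \<subseteq> permutations_of_set A"
    and "\<And>b. b \<in> A - {a} \<Longrightarrow> d b \<le> of_nat (n_prefer P b a)"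
  shows "\<exists>q. schedule_optimum A P a d q"
proof -
  have "\<exists>y. schedule A P a d y \<and> (\<forall>y'. schedule A P a d y' \<longrightarrow>
      (\<Sum>s\<in>slots A a. 1 * y s) \<le> (\<Sum>s\<in>slots A a. 1 * y' s))"
  proof (rule polyhedral_minimum[OF finite_slots polyhedral_schedule[OF assms(1)] schedule_full[OF assms(2,3)]])
    show "0 \<le> (\<Sum>s\<in>slots A a. 1 * y s)" if "schedule A P a d y" for y
      using that by (intro sum_nonneg) (auto simp: schedule_def)
  qed
  thus ?thesis unfolding schedule_optimum_def by auto
qed

text \<open>
  Rounding up preserves all the conditions, because the upper bounds are integers.
\<close>

lemma schedule_round_up:
  assumes y: "schedule A P a d y"
  shows "schedule A P a d (\<lambda>s. of_nat (nat \<lceil>y s\<rceil>))"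
proof -
  have "0 \<le> y (t, c)" "y (t, c) \<le> of_nat (count (mset P) t)" if "(t, c) \<in> slots A a" for t c
    using y that unfolding schedule_def by fastforce+
  hence "nat \<lceil>y (t, c)\<rceil> \<le> count (mset P) t" if "(t, c) \<in> slots A a" for t c
    using that by (simp add: nat_le_iff ceiling_le_iff)
  moreover have "nat \<lceil>y (t, c)\<rceil> \<le> nat \<lceil>y (t, c')\<rceil>"
    if "(t, c') \<in> slots A a" "prefers t c c'" for t c c'
  proof -
    have "y (t, c) \<le> y (t, c')" using y that unfolding schedule_def by fastforce
    thus ?thesis by (intro nat_mono ceiling_mono)
  qed
  moreover have "d b \<le> (\<Sum>t | (t, b) \<in> slots A a. of_nat (nat \<lceil>y (t, b)\<rceil>))" if "b \<in> A - {a}" for b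
  proof -
    have "d b \<le> (\<Sum>t | (t, b) \<in> slots A a. y (t, b))"
      using y that unfolding schedule_def by blast
    also have "\<dots> \<le> (\<Sum>t | (t, b) \<in> slots A a. of_nat (nat \<lceil>y (t, b)\<rceil>))"
      by (intro sum_mono) (rule of_nat_ceiling)
    finally show ?thesis .
  qed
  ultimately show ?thesis unfolding schedule_def by auto
qed

text \<open>
  The optimum of the relaxation is at most the integral one. Conversely, rounding up an optimal
  rational schedule costs at most 1 for each slot, and the result is integral.
\<close>

lemma schedule_optimum_close_to_dodgson:
  assumes P: "set P \<subseteq> permutations_of_set A" "a \<in> A"
    and q: "schedule_optimum A P a d q"
    and d: "\<And>b. b \<in> A - {a} \<Longrightarrow> margin P a b \<le> d b"
      "\<And>b k. \<lbrakk>b \<in> A - {a}; margin P a b \<le> of_nat k\<rbrakk> \<Longrightarrow> d b \<le> of_nat k"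
  shows "q \<le> of_nat (dodgson_score A P a)"
    "of_nat (dodgson_score A P a) \<le> q + of_nat (card (slots A a))"
proof -
  obtain y where y: "schedule A P a (margin P a) (\<lambda>s. of_nat (y s))"
    "(\<Sum>s\<in>slots A a. y s) = dodgson_score A P a"
    using dodgson_schedule[OF P] by blast
  have "d b \<le> (\<Sum>t | (t, b) \<in> slots A a. of_nat (y (t, b)))" if "b \<in> A - {a}" for b
    unfolding of_nat_sum[symmetric]
    by (rule d(2)[OF that]) (use y(1) that in \<open>simp add: schedule_def\<close>)
  hence "schedule A P a d (\<lambda>s. of_nat (y s))"
    using y(1) by (simp add: schedule_def)
  hence "q \<le> (\<Sum>s\<in>slots A a. of_nat (y s))"
    using q unfolding schedule_optimum_def by blast
  thus "q \<le> of_nat (dodgson_score A P a)"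
    using arg_cong[OF y(2), of "of_nat :: nat \<Rightarrow> rat"] by simp
  obtain z where z: "schedule A P a d z" "q = (\<Sum>s\<in>slots A a. z s)"
    using q unfolding schedule_optimum_def by blast
  have "schedule A P a (margin P a) (\<lambda>s. of_nat (nat \<lceil>z s\<rceil>))"
    using schedule_demand_mono[OF schedule_round_up[OF z(1)]] d(1) by blast
  from dodgson_score_le[OF P this]
  have "(of_nat (dodgson_score A P a) :: rat) \<le> of_nat (\<Sum>s\<in>slots A a. nat \<lceil>z s\<rceil>)"
    by (rule of_nat_mono)
  also have "\<dots> = (\<Sum>s\<in>slots A a. of_nat (nat \<lceil>z s\<rceil>))" by simp
  also have "\<dots> \<le> (\<Sum>s\<in>slots A a. z s + 1)"
  proof (intro sum_mono)
    fix s assume "s \<in> slots A a"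
    hence "0 \<le> z s" using z(1) unfolding schedule_def by (cases s) auto
    thus "of_nat (nat \<lceil>z s\<rceil>) \<le> z s + 1"
      using of_int_ceiling_le_add_one[of "z s"] by simp
  qed
  also have "\<dots> = q + of_nat (card (slots A a))"
    by (simp add: sum.distrib z(2))
  finally show "of_nat (dodgson_score A P a) \<le> q + of_nat (card (slots A a))" .
qed

section \<open>The DR score as a linear program\<close>

text \<open>
  The fraction of vote \<open>i\<close> in which a DR solution \<open>x\<close> raises \<open>a\<close> above \<open>c\<close>, for \<open>c\<close> above
  \<open>a\<close> in that vote: the parts that move \<open>a\<close> up by at least the distance to \<open>c\<close>.
\<close>

definition raised_fraction :: "'a profile \<Rightarrow> 'a \<Rightarrow> (nat \<Rightarrow> nat \<Rightarrow> rat) \<Rightarrow> nat \<Rightarrow> 'a \<Rightarrow> rat" where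
  "raised_fraction P a x i c =
     (\<Sum>j\<le>n_above (P ! i) a. of_bool (n_above (P ! i) a - n_above (P ! i) c \<le> j) * x i j)"

definition total_raises :: "'a profile \<Rightarrow> 'a \<Rightarrow> (nat \<Rightarrow> nat \<Rightarrow> rat) \<Rightarrow> 'a vote \<times> 'a \<Rightarrow> rat" where
  "total_raises P a x = (\<lambda>(t, c). \<Sum>i | i < length P \<and> P ! i = t. raised_fraction P a x i c)"

lemma total_raises_demand:
  assumes P: "set P \<subseteq> permutations_of_set A" and "a \<in> A"
  shows "(\<Sum>t | (t, b) \<in> slots A a. total_raises P a x (t, b)) =
    (\<Sum>i<length P. \<Sum>j\<le>n_above (P ! i) a. of_bool (raises_above (P ! i) a j b) * x i j)"
proof -
  have "(\<Sum>t | (t, b) \<in> slots A a. total_raises P a x (t, b)) =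
      (\<Sum>i\<in>{i \<in> {..<length P}. prefers (P ! i) b a}. raised_fraction P a x i b)"
    unfolding total_raises_def prod.case sum_by_vote[OF P] by simp
  also have "\<dots> = (\<Sum>i<length P. if prefers (P ! i) b a then raised_fraction P a x i b else 0)"
    by (rule sum.inter_filter) simp
  also have "\<dots> = (\<Sum>i<length P. \<Sum>j\<le>n_above (P ! i) a. of_bool (raises_above (P ! i) a j b) * x i j)"
  proof (intro sum.cong refl)
    fix i assume "i \<in> {..<length P}"
    hence "raises_above (P ! i) a j b \<longleftrightarrow>
        prefers (P ! i) b a \<and> n_above (P ! i) a - n_above (P ! i) b \<le> j" for j
      using profile_nth[OF P, of i] assms(2) by (intro raises_above_iff) auto
    thus "(if prefers (P ! i) b a then raised_fraction P a x i b else 0) =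
        (\<Sum>j\<le>n_above (P ! i) a. of_bool (raises_above (P ! i) a j b) * x i j)"
      by (simp add: raised_fraction_def)
  qed
  finally show ?thesis .
qed

text \<open>
  Moving a part of a vote up by \<open>j\<close> positions passes exactly \<open>j\<close> alternatives.
\<close>

lemma total_raises_cost:
  assumes P: "set P \<subseteq> permutations_of_set A" and "a \<in> A"
  shows "(\<Sum>s\<in>slots A a. total_raises P a x s) =
    (\<Sum>i<length P. \<Sum>j\<le>n_above (P ! i) a. of_nat j * x i j)"
proof -
  have "(\<Sum>s\<in>slots A a. total_raises P a x s) =
      (\<Sum>i<length P. \<Sum>c | prefers (P ! i) c a. raised_fraction P a x i c)"
    unfolding total_raises_def by (rule sum_slots_by_vote[OF P])
  also have "\<dots> = (\<Sum>i<length P. \<Sum>j\<le>n_above (P ! i) a. of_nat j * x i j)"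
  proof (intro sum.cong refl)
    fix i assume "i \<in> {..<length P}"
    hence v: "distinct (P ! i)" "a \<in> set (P ! i)"
      using profile_nth[OF P, of i] assms(2) by auto
    have "(\<Sum>c | prefers (P ! i) c a. raised_fraction P a x i c) =
        (\<Sum>j\<le>n_above (P ! i) a. \<Sum>c | prefers (P ! i) c a.
           of_bool (n_above (P ! i) a - n_above (P ! i) c \<le> j) * x i j)"
      unfolding raised_fraction_def by (rule sum.swap)
    also have "\<dots> = (\<Sum>j\<le>n_above (P ! i) a. of_nat j * x i j)"
    proof (intro sum.cong refl)
      fix j assume "j \<in> {..n_above (P ! i) a}"
      thus "(\<Sum>c | prefers (P ! i) c a. of_bool (n_above (P ! i) a - n_above (P ! i) c \<le> j) * x i j) =
          of_nat j * x i j"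
        using card_above_within[OF v, of j] finite_above[of "P ! i" a]
        by (simp add: sum_distrib_right[symmetric] Int_def)
    qed
    finally show "(\<Sum>c | prefers (P ! i) c a. raised_fraction P a x i c) =
        (\<Sum>j\<le>n_above (P ! i) a. of_nat j * x i j)" .
  qed
  finally show ?thesis .
qed

lemma dr_feasible_schedule:
  assumes P: "set P \<subseteq> permutations_of_set A" and "a \<in> A" and x: "dr_feasible A P a x"
  shows "schedule A P a (\<lambda>b. of_int (F_req P b a)) (total_raises P a x)"
proof -
  have nonneg: "0 \<le> x i j" if "i < length P" "j \<le> n_above (P ! i) a" for i j
    using x that unfolding dr_feasible_def by blast
  have total: "(\<Sum>j\<le>n_above (P ! i) a. x i j) = 1" if "i < length P" for i
    using x that unfolding dr_feasible_def by blast
  have fraction: "0 \<le> raised_fraction P a x i c" "raised_fraction P a x i c \<le> 1" if "i < length P" for i c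
  proof -
    show "0 \<le> raised_fraction P a x i c"
      unfolding raised_fraction_def using nonneg[OF that] by (intro sum_nonneg) auto
    have "raised_fraction P a x i c \<le> (\<Sum>j\<le>n_above (P ! i) a. x i j)"
      unfolding raised_fraction_def using nonneg[OF that] by (intro sum_mono) auto
    thus "raised_fraction P a x i c \<le> 1" by (simp add: total[OF that])
  qed
  have "0 \<le> total_raises P a x (t, c)" for t c
    unfolding total_raises_def prod.case using fraction(1) by (intro sum_nonneg) auto
  moreover have "total_raises P a x (t, c) \<le> of_nat (count (mset P) t)" for t c
    unfolding total_raises_def prod.case count_eq_sum of_nat_sum of_nat_1
    using fraction(2) by (intro sum_mono) auto
  moreover have "total_raises P a x (t, c) \<le> total_raises P a x (t, c')"
    if "(t, c') \<in> slots A a" "prefers t c c'" for t c c'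
  proof -
    have "n_above t c \<le> n_above t c'"
      using slots_voteD[OF that(1)] prefers_in_set[OF that(2)] prefers_iff_n_above[of t c c'] that(2)
      by simp
    thus ?thesis
      unfolding total_raises_def prod.case raised_fraction_def
      using nonneg by (intro sum_mono mult_right_mono) auto
  qed
  moreover have "of_int (F_req P b a) \<le> (\<Sum>t | (t, b) \<in> slots A a. total_raises P a x (t, b))"
    if "b \<in> A - {a}" for b
    unfolding total_raises_demand[OF P assms(2)] using x that unfolding dr_feasible_def by blast
  ultimately show ?thesis unfolding schedule_def by auto
qed

lemma sum_tail_telescope:
  fixes f :: "nat \<Rightarrow> 'b::comm_ring_1"
  assumes "l \<le> p"
  shows "(\<Sum>j\<le>p. of_bool (l \<le> j) * (f j - f (Suc j))) = f l - f (Suc p)"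
proof -
  have "(\<Sum>j\<le>p. of_bool (l \<le> j) * (f j - f (Suc j))) = (\<Sum>j\<in>{l..p}. f j - f (Suc j))"
    by (intro sum.mono_neutral_cong_right) auto
  also have "\<dots> = f l - f (Suc p)"
    using assms by (induction p rule: dec_induct) simp_all
  finally show ?thesis .
qed

text \<open>
  A rational schedule is shared equally among the voters of each type. As a function of the
  distance \<open>j\<close>, the schedule gives the amount \<open>Y t j\<close> moved up by at least \<open>j\<close> positions, and
  its decrements give the amounts moved up by exactly \<open>j\<close>.
\<close>

lemma schedule_dr_feasible:
  assumes P: "set P \<subseteq> permutations_of_set A" and a: "a \<in> A"
    and y: "schedule A P a (\<lambda>b. of_int (F_req P b a)) y"
  shows "\<exists>x. dr_feasible A P a x \<and>
    (\<Sum>s\<in>slots A a. y s) = (\<Sum>i<length P. \<Sum>j\<le>n_above (P ! i) a. of_nat j * x i j)"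
proof -
  have y_bounds: "0 \<le> y (t, c)" "y (t, c) \<le> of_nat (count (mset P) t)" if "(t, c) \<in> slots A a" for t c
    using y that unfolding schedule_def by fastforce+
  have y_mono: "y (t, c) \<le> y (t, c')" if "(t, c') \<in> slots A a" "prefers t c c'" for t c c'
    using y that unfolding schedule_def by fastforce
  \<comment> \<open>The alternative at distance \<open>j\<close> above \<open>a\<close> in \<open>t\<close> is \<open>t ! (n_above t a - j)\<close>. All votes
    move up by at least 0 positions, and none beyond the top.\<close>
  define Y where "Y t j = (if j = 0 then of_nat (count (mset P) t)
      else if j \<le> n_above t a then y (t, t ! (n_above t a - j)) else 0)" for t j
  define x where "x i j = (Y (P ! i) j - Y (P ! i) (Suc j)) / of_nat (count (mset P) (P ! i))" for i j
  have slot: "(t, t ! (n_above t a - j)) \<in> slots A a"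
    and slot_pos: "n_above t (t ! (n_above t a - j)) = n_above t a - j"
    if "t \<in> permutations_of_set A" "0 < j" "j \<le> n_above t a" for t j
  proof -
    have t: "distinct t" "set t = A" using that(1) by (auto dest: permutations_of_setD)
    hence "n_above t a < length t" using a by (auto simp: in_set_conv_nth n_above_nth)
    with t that show pos: "n_above t (t ! (n_above t a - j)) = n_above t a - j"
      by (simp add: n_above_nth)
    have "t ! (n_above t a - j) \<in> set t" using \<open>n_above t a < length t\<close> by simp
    with pos t that a show "(t, t ! (n_above t a - j)) \<in> slots A a"
      using prefers_iff_n_above[of t "t ! (n_above t a - j)" a] by (simp add: slots_def)
  qed
  have Y_mono: "Y t (Suc j) \<le> Y t j" if t: "t \<in> permutations_of_set A" for t j
  proof -
    consider "Suc j > n_above t a" | "j = 0" "Suc j \<le> n_above t a" | "0 < j" "Suc j \<le> n_above t a"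
      by linarith
    thus ?thesis
    proof cases
      case 1
      thus ?thesis using y_bounds(1) slot[OF t, of j] by (auto simp: Y_def)
    next
      case 2
      thus ?thesis using y_bounds(2) slot[OF t, of 1] by (auto simp: Y_def)
    next
      case 3
      note s = slot[OF t, of j] slot[OF t, of "Suc j"]
      have "prefers t (t ! (n_above t a - Suc j)) (t ! (n_above t a - j))"
        using 3 slot_pos[OF t, of j] slot_pos[OF t, of "Suc j"] s
          slots_voteD(3,4,5)[OF s(1)] slots_voteD(5)[OF s(2)]
          prefers_iff_n_above[of t "t ! (n_above t a - Suc j)" "t ! (n_above t a - j)"]
        by simp
      with 3 s y_mono show ?thesis by (simp add: Y_def)
    qed
  qed
  have count: "count (mset P) (P ! i) > 0" if "i < length P" for i
    using that by simp
  have tail: "(\<Sum>j\<le>n_above (P ! i) a. of_bool (l \<le> j) * x i j) =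
      Y (P ! i) l / of_nat (count (mset P) (P ! i))" if "l \<le> n_above (P ! i) a" for i l
  proof -
    have "(\<Sum>j\<le>n_above (P ! i) a. of_bool (l \<le> j) * x i j) =
        (\<Sum>j\<le>n_above (P ! i) a. of_bool (l \<le> j) * (Y (P ! i) j - Y (P ! i) (Suc j))) /
        of_nat (count (mset P) (P ! i))"
      by (simp only: x_def sum_divide_distrib times_divide_eq_right)
    also have "Y (P ! i) (Suc (n_above (P ! i) a)) = 0" by (simp add: Y_def)
    hence "(\<Sum>j\<le>n_above (P ! i) a. of_bool (l \<le> j) * (Y (P ! i) j - Y (P ! i) (Suc j))) = Y (P ! i) l"
      by (simp add: sum_tail_telescope[OF that])
    finally show ?thesis .
  qed
  have raises: "total_raises P a x s = y s" if "s \<in> slots A a" for s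
  proof -
    obtain t c where s: "s = (t, c)" by (cases s)
    note t = slots_voteD[OF that[unfolded s]]
    have pos: "n_above t c < n_above t a" using t prefers_iff_n_above[of t c a] by simp
    have "t ! n_above t c = c"
      using t by (auto simp: in_set_conv_nth n_above_nth)
    hence "Y t (n_above t a - n_above t c) = y (t, c)"
      using pos by (simp add: Y_def)
    hence "raised_fraction P a x i c = y (t, c) / of_nat (count (mset P) t)" if "P ! i = t" for i
      unfolding raised_fraction_def that using tail[of "n_above t a - n_above t c" i] that by simp
    hence "total_raises P a x s =
        (\<Sum>i | i < length P \<and> P ! i = t. y (t, c) / of_nat (count (mset P) t))"
      unfolding s total_raises_def prod.case by (intro sum.cong) auto
    also have "\<dots> = of_nat (count (mset P) t) * (y (t, c) / of_nat (count (mset P) t))"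
      by (simp add: count_eq_sum)
    also have "\<dots> = y (t, c)"
      using y_bounds[OF that[unfolded s]] by (cases "count (mset P) t = 0") auto
    finally show ?thesis by (simp add: s)
  qed
  have "dr_feasible A P a x"
    unfolding dr_feasible_def total_raises_demand[OF P a, symmetric]
  proof (intro conjI allI impI ballI)
    fix i j assume "i < length P"
    thus "0 \<le> x i j" using Y_mono profile_nth(3)[OF P] by (simp add: x_def)
  next
    fix i assume "i < length P"
    with tail[of 0 i] count show "(\<Sum>j\<le>n_above (P ! i) a. x i j) = 1"
      by (simp add: Y_def)
  next
    fix b assume "b \<in> A - {a}"
    moreover have "(\<Sum>t | (t, b) \<in> slots A a. total_raises P a x (t, b)) =
        (\<Sum>t | (t, b) \<in> slots A a. y (t, b))"
      using raises by (intro sum.cong) auto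
    ultimately show "of_int (F_req P b a) \<le> (\<Sum>t | (t, b) \<in> slots A a. total_raises P a x (t, b))"
      using y unfolding schedule_def by simp
  qed
  moreover have "(\<Sum>s\<in>slots A a. y s) = (\<Sum>s\<in>slots A a. total_raises P a x s)"
    using raises by (intro sum.cong) auto
  ultimately show ?thesis
    unfolding total_raises_cost[OF P a] by blast
qed

text \<open>
  Rounding the demand up to an integer does not affect integral schedules. For these the DR
  demands \<^const>\<open>F_req\<close> and the demands \<^const>\<open>margin\<close> of the Dodgson and DC scores agree.
\<close>

lemma F_req_le_iff: "F_req P b a \<le> int k \<longleftrightarrow> margin P a b \<le> of_nat k"
  by (auto simp: F_req_def ceiling_le_iff adv_def margin_def)

lemma margin_le_F_req: "margin P a b \<le> of_int (F_req P b a)"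
proof -
  have "0 \<le> F_req P b a" by (simp add: F_req_def adv_def)
  thus ?thesis using F_req_le_iff[of P b a "nat (F_req P b a)"] by simp
qed

lemma dr_score_optimum:
  assumes "finite A" and P: "set P \<subseteq> permutations_of_set A" "a \<in> A"
  shows "schedule_optimum A P a (\<lambda>b. of_int (F_req P b a)) (dr_score A P a)"
proof -
  have "(of_int (F_req P b a) :: rat) \<le> of_nat (n_prefer P b a)" for b
    using F_req_le_iff[of P b a "n_prefer P b a"] margin_le_n_prefer[of P a b]
    by (metis of_int_le_iff of_int_of_nat_eq)
  then obtain q where q: "schedule_optimum A P a (\<lambda>b. of_int (F_req P b a)) q"
    using schedule_optimum_exists[OF assms(1,2), of a "\<lambda>b. of_int (F_req P b a)"] by blast
  have "dr_score A P a = q"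
    unfolding dr_score_def
  proof (rule Least_equality)
    show "\<exists>x. dr_feasible A P a x \<and>
        q = (\<Sum>i<length P. \<Sum>j\<le>n_above (P ! i) a. of_nat j * x i j)"
      using q schedule_dr_feasible[OF P] unfolding schedule_optimum_def by blast
    fix c assume "\<exists>x. dr_feasible A P a x \<and>
        c = (\<Sum>i<length P. \<Sum>j\<le>n_above (P ! i) a. of_nat j * x i j)"
    then obtain x where "dr_feasible A P a x" "c = (\<Sum>s\<in>slots A a. total_raises P a x s)"
      unfolding total_raises_cost[OF P] by blast
    thus "q \<le> c"
      using q dr_feasible_schedule[OF P] unfolding schedule_optimum_def by blast
  qed
  with q show ?thesis by simp
qed

section \<open>The DC score as a linear program\<close>

lemma count_clones: "count (mset (clones k P)) t = k * count (mset P) t"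
  by (induction P) (auto simp: clones_def)

lemma n_prefer_clones: "n_prefer (clones k P) x y = k * n_prefer P x y"
  by (induction P) (auto simp: clones_def n_prefer_eq_length_filter filter_replicate)

lemma margin_clones: "margin (clones k P) a b = of_nat k * margin P a b"
  by (simp add: margin_def n_prefer_clones right_diff_distrib)

lemma set_clones: "set (clones k P) \<subseteq> set P"
  by (auto simp: clones_def)

lemma schedule_clones:
  assumes "k > 0"
  shows "schedule A (clones k P) a (margin (clones k P) a) (\<lambda>s. of_nat k * y s) \<longleftrightarrow>
         schedule A P a (margin P a) y"
  using assms
  by (simp add: schedule_def count_clones margin_clones sum_distrib_left[symmetric]
      zero_le_mult_iff case_prod_unfold)

lemma common_denominator:
  fixes y :: "'s \<Rightarrow> rat"
  assumes "finite S" "\<And>s. s \<in> S \<Longrightarrow> 0 \<le> y s"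
  shows "\<exists>k>0. \<forall>s\<in>S. \<exists>m. of_nat k * y s = of_nat m"
  using assms
proof (induction S rule: finite_induct)
  case (insert s S)
  then obtain k where k: "k > 0" "\<And>s. s \<in> S \<Longrightarrow> \<exists>m. of_nat k * y s = of_nat m" by auto
  obtain p q where pq: "quotient_of (y s) = (p, q)" by (cases "quotient_of (y s)")
  hence q: "q > 0" "y s = of_int p / of_int q"
    using quotient_of_denom_pos quotient_of_div by auto
  have "p \<ge> 0" using insert.prems[of s] q by (simp add: zero_le_divide_iff)
  with q have "of_nat (nat q * k) * y s = of_nat (nat p * k)"
    by (simp add: of_nat_nat)
  moreover have "\<exists>m. of_nat (nat q * k) * y t = of_nat m" if t: "t \<in> S" for t
  proof -
    obtain m where "of_nat k * y t = of_nat m" using k(2)[OF t] by blast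
    hence "of_nat (nat q * k) * y t = of_nat (nat q * m)" by simp
    thus ?thesis by blast
  qed
  moreover have "nat q * k > 0" using q(1) k(1) by simp
  ultimately show ?case by blast
qed auto

text \<open>
  A schedule for \<open>k\<close> clones of every voter is \<open>k\<close> times a rational schedule for the original
  profile, so no number of clones beats the rational optimum. For \<open>k\<close> a common denominator of an
  optimal rational schedule the multiple is integral, and the optimum is attained.
\<close>

lemma dc_score_optimum:
  assumes "finite A" and P: "set P \<subseteq> permutations_of_set A" "a \<in> A"
  shows "schedule_optimum A P a (margin P a) (dc_score A P a)"
proof -
  obtain q where q: "schedule_optimum A P a (margin P a) q"
    using schedule_optimum_exists[OF assms(1,2) margin_le_n_prefer] by blast
  have clonesP: "set (clones k P) \<subseteq> permutations_of_set A" for k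
    using set_clones P(1) by blast
  have lower: "q \<le> of_nat (dodgson_score A (clones k P) a) / of_nat k" if "k > 0" for k
  proof -
    obtain y where y: "schedule A (clones k P) a (margin (clones k P) a) (\<lambda>s. of_nat (y s))"
      "(\<Sum>s\<in>slots A a. y s) = dodgson_score A (clones k P) a"
      using dodgson_schedule[OF clonesP P(2)] by blast
    have "schedule A P a (margin P a) (\<lambda>s. of_nat (y s) / of_nat k)"
      using y(1) schedule_clones[OF that, of A P a "\<lambda>s. of_nat (y s) / of_nat k"] that by simp
    hence "q \<le> (\<Sum>s\<in>slots A a. of_nat (y s) / of_nat k)"
      using q unfolding schedule_optimum_def by blast
    thus ?thesis
      by (simp add: y(2)[symmetric] sum_divide_distrib)
  qed
  have "dc_score A P a = q"
    unfolding dc_score_def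
  proof (rule Least_equality)
    obtain y where y: "schedule A P a (margin P a) y" "q = (\<Sum>s\<in>slots A a. y s)"
      using q unfolding schedule_optimum_def by blast
    have "0 \<le> y s" if "s \<in> slots A a" for s
      using y(1) that unfolding schedule_def by (cases s) auto
    then obtain k where k: "k > 0" "\<forall>s\<in>slots A a. \<exists>m. of_nat k * y s = of_nat m"
      using common_denominator[of "slots A a" y, OF finite_slots] by blast
    then obtain m where m: "\<And>s. s \<in> slots A a \<Longrightarrow> of_nat k * y s = of_nat (m s)"
      by metis
    have "schedule A (clones k P) a (margin (clones k P) a) (\<lambda>s. of_nat k * y s)"
      using y(1) k(1) by (simp add: schedule_clones)
    hence "schedule A (clones k P) a (margin (clones k P) a) (\<lambda>s. of_nat (m s))"
      using schedule_cong[of A a "\<lambda>s. of_nat k * y s" "\<lambda>s. of_nat (m s)"] m by blast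
    from dodgson_score_le[OF clonesP P(2) this]
    have "(of_nat (dodgson_score A (clones k P) a) :: rat) \<le> of_nat (\<Sum>s\<in>slots A a. m s)"
      by (rule of_nat_mono)
    also have "\<dots> = (\<Sum>s\<in>slots A a. of_nat k * y s)" by (simp add: m)
    also have "\<dots> = of_nat k * q" by (simp add: y(2) sum_distrib_left)
    finally have "of_nat (dodgson_score A (clones k P) a) / of_nat k \<le> q"
      using k(1) by (simp add: divide_le_eq mult.commute)
    with lower[OF k(1)] k(1) show "\<exists>k\<ge>1. q = of_nat (dodgson_score A (clones k P) a) / of_nat k"
      by (intro exI[of _ k]) auto
  next
    show "q \<le> c" if "\<exists>k\<ge>1. c = of_nat (dodgson_score A (clones k P) a) / of_nat k" for c
      using that lower by auto
  qed
  with q show ?thesis by simp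
qed

section \<open>Winners under close scores\<close>

text \<open>
  The map \<open>h\<close> brings the second score to the scale of the first. Scores that differ by more than
  \<open>2 * K\<close> keep their order when each is perturbed by at most \<open>K\<close>.
\<close>

lemma winners_of_close_score:
  fixes sc :: "'a \<Rightarrow> 'b::linorder" and f :: "'a \<Rightarrow> nat" and h :: "'b \<Rightarrow> rat"
  assumes h: "strict_mono h"
    and close: "\<And>a. a \<in> A \<Longrightarrow> of_nat (f a) \<le> h (sc a) + of_nat K"
      "\<And>a. a \<in> A \<Longrightarrow> h (sc a) \<le> of_nat (f a) + of_nat K"
    and gap: "\<And>a b. \<lbrakk>a \<in> A; b \<in> A; a \<noteq> b\<rbrakk> \<Longrightarrow> int (2 * K) < \<bar>int (f a) - int (f b)\<bar>"
  shows "winners A sc = winners A f"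
proof -
  have less: "sc a < sc b" if ab: "a \<in> A" "b \<in> A" "f a < f b" for a b
  proof -
    have "f a + 2 * K < f b"
      using gap[OF ab(1,2)] ab(3) by fastforce
    hence "(of_nat (f a + 2 * K) :: rat) < of_nat (f b)" by (rule of_nat_less_iff[THEN iffD2])
    with close(1)[OF ab(2)] close(2)[OF ab(1)] have "h (sc a) < h (sc b)" by simp
    thus ?thesis using h by (simp add: strict_mono_less)
  qed
  have "sc a \<le> sc b \<longleftrightarrow> f a \<le> f b" if "a \<in> A" "b \<in> A" for a b
  proof (cases "a = b")
    case False
    with gap[of a b] that have "f a \<noteq> f b" by auto
    with less[of a b] less[of b a] that show ?thesis
      by (cases "f a" "f b" rule: linorder_cases) (auto simp: not_le)
  qed simp
  thus ?thesis unfolding winners_def by auto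
qed

text \<open>
  Each of the at most \<open>card A\<close> ceilings exceeds half the advantage by at most 1/2.
\<close>

lemma dq_score_bounds:
  assumes "finite A"
  shows "tideman_score A P a \<le> 2 * dq_score A P a"
    "2 * dq_score A P a \<le> tideman_score A P a + int (card A)"
proof -
  have F: "adv P b a \<le> 2 * F_req P b a" "2 * F_req P b a \<le> adv P b a + 1" for b
    unfolding F_req_def by linarith+
  show "tideman_score A P a \<le> 2 * dq_score A P a"
    unfolding tideman_score_def dq_score_def sum_distrib_left using F(1) by (intro sum_mono)
  have "2 * dq_score A P a \<le> (\<Sum>b\<in>A - {a}. adv P b a + 1)"
    unfolding dq_score_def sum_distrib_left using F(2) by (intro sum_mono)
  also have "\<dots> = tideman_score A P a + int (card (A - {a}))"
    by (simp add: tideman_score_def sum.distrib)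
  also have "card (A - {a}) \<le> card A" using assms by (intro card_mono) auto
  finally show "2 * dq_score A P a \<le> tideman_score A P a + int (card A)" by simp
qed

lemma winners_dq_tideman:
  assumes "finite A"
    and gap: "\<And>a b. \<lbrakk>a \<in> A; b \<in> A; a \<noteq> b\<rbrakk> \<Longrightarrow>
      int (2 * card A) < \<bar>int (nat (tideman_score A P a)) - int (nat (tideman_score A P b))\<bar>"
  shows "winners A (dq_score A P) = winners A (tideman_score A P)"
proof -
  have nonneg: "0 \<le> tideman_score A P a" for a
    unfolding tideman_score_def by (intro sum_nonneg) (simp add: adv_def)
  have cast: "of_nat (nat (tideman_score A P a)) = (of_int (tideman_score A P a) :: rat)" for a
    using nonneg by simp
  have "winners A (dq_score A P) = winners A (\<lambda>a. nat (tideman_score A P a))"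
  proof (rule winners_of_close_score[where h = "\<lambda>q. 2 * of_int q" and K = "card A"])
    fix a
    have "(of_int (tideman_score A P a) :: rat) \<le> of_int (2 * dq_score A P a)"
      "(of_int (2 * dq_score A P a) :: rat) \<le> of_int (tideman_score A P a + int (card A))"
      using dq_score_bounds[OF assms(1), of P a] by (simp_all only: of_int_le_iff)
    thus "of_nat (nat (tideman_score A P a)) \<le> 2 * of_int (dq_score A P a) + (of_nat (card A) :: rat)"
      "2 * of_int (dq_score A P a) \<le> of_nat (nat (tideman_score A P a)) + (of_nat (card A) :: rat)"
      unfolding cast by simp_all
  qed (use gap in \<open>auto simp: strict_mono_def\<close>)
  also have "\<dots> = winners A (tideman_score A P)"
    using nonneg by (simp add: winners_def nat_le_eq_zle)
  finally show ?thesis .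
qed

text \<open>
  DR and DC are within the number of slots of Dodgson. D& lies between DR and Dodgson, since
  the Dodgson score is an integer that is at least the DR score.
\<close>

lemma winners_dodgson_relaxations:
  assumes "finite A" and P: "set P \<subseteq> permutations_of_set A"
    and K: "\<And>a. a \<in> A \<Longrightarrow> card (slots A a) \<le> K"
    and gap: "\<And>a b. \<lbrakk>a \<in> A; b \<in> A; a \<noteq> b\<rbrakk> \<Longrightarrow>
      int (2 * K) < \<bar>int (dodgson_score A P a) - int (dodgson_score A P b)\<bar>"
  shows "winners A (dr_score A P) = winners A (dodgson_score A P)"
    "winners A (dc_score A P) = winners A (dodgson_score A P)"
    "winners A (dand_score A P) = winners A (dodgson_score A P)"
proof -
  have dr: "dr_score A P a \<le> of_nat (dodgson_score A P a)"
    "of_nat (dodgson_score A P a) \<le> dr_score A P a + of_nat K" if a: "a \<in> A" for a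
  proof -
    have "of_int (F_req P b a) \<le> (of_nat k :: rat)" if "margin P a b \<le> of_nat k" for b k
      using that F_req_le_iff[of P b a k] by (metis of_int_le_iff of_int_of_nat_eq)
    note * = schedule_optimum_close_to_dodgson[OF P a dr_score_optimum[OF assms(1) P a] margin_le_F_req this]
    show "dr_score A P a \<le> of_nat (dodgson_score A P a)" by (rule *(1))
    have "(of_nat (card (slots A a)) :: rat) \<le> of_nat K" using K[OF a] by simp
    with *(2) show "of_nat (dodgson_score A P a) \<le> dr_score A P a + of_nat K" by linarith
  qed
  have dc: "dc_score A P a \<le> of_nat (dodgson_score A P a)"
    "of_nat (dodgson_score A P a) \<le> dc_score A P a + of_nat K" if a: "a \<in> A" for a
  proof -
    note * = schedule_optimum_close_to_dodgson[OF P a dc_score_optimum[OF assms(1) P a] order_refl]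
    show "dc_score A P a \<le> of_nat (dodgson_score A P a)" by (rule *(1))
    have "(of_nat (card (slots A a)) :: rat) \<le> of_nat K" using K[OF a] by simp
    with *(2) show "of_nat (dodgson_score A P a) \<le> dc_score A P a + of_nat K" by force
  qed
  show "winners A (dr_score A P) = winners A (dodgson_score A P)"
    by (rule winners_of_close_score[where h = "\<lambda>q. q" and K = K])
       (use dr gap in \<open>auto simp: strict_mono_def intro: add_increasing2\<close>)
  show "winners A (dc_score A P) = winners A (dodgson_score A P)"
    by (rule winners_of_close_score[where h = "\<lambda>q. q" and K = K])
       (use dc gap in \<open>auto simp: strict_mono_def intro: add_increasing2\<close>)
  show "winners A (dand_score A P) = winners A (dodgson_score A P)"
  proof (rule winners_of_close_score[where h = of_int and K = K])
    fix a assume a: "a \<in> A"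
    have "dr_score A P a \<le> of_int (dand_score A P a)"
      by (simp add: dand_score_def)
    with dr(2)[OF a] show "of_nat (dodgson_score A P a) \<le> of_int (dand_score A P a) + (of_nat K :: rat)"
      by simp
    have "dand_score A P a \<le> int (dodgson_score A P a)"
      using dr(1)[OF a] by (simp add: dand_score_def ceiling_le_iff)
    hence "(of_int (dand_score A P a) :: rat) \<le> of_int (int (dodgson_score A P a))"
      by (simp only: of_int_le_iff)
    thus "of_int (dand_score A P a) \<le> of_nat (dodgson_score A P a) + (of_nat K :: rat)"
      by simp
  qed (use gap in \<open>auto simp: strict_mono_def\<close>)
qed

theorem corollary4p7:
  fixes A :: "'a set"
  assumes "finite A"
  shows "((\<lambda>n. measure_pmf.prob (IAC A n) (situation_event (\<lambda>P.
             winners A (dq_score A P) = winners A (tideman_score A P)))) \<longlonglongrightarrow> 1) \<and>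
         ((\<lambda>n. measure_pmf.prob (IAC A n) (situation_event (\<lambda>P.
             winners A (dr_score A P) = winners A (dodgson_score A P) \<and>
             winners A (dc_score A P) = winners A (dodgson_score A P) \<and>
             winners A (dand_score A P) = winners A (dodgson_score A P)))) \<longlonglongrightarrow> 1)"
proof
  show "(\<lambda>n. measure_pmf.prob (IAC A n) (situation_event (\<lambda>P.
      winners A (dq_score A P) = winners A (tideman_score A P)))) \<longlonglongrightarrow> 1"
    by (rule steep_score.almost_all_situations[OF steep_score_tideman[OF assms] assms])
       (rule winners_dq_tideman[OF assms])
  define K where "K = (\<Sum>a\<in>A. card (slots A a))"
  have K: "card (slots A a) \<le> K" if "a \<in> A" for a
    unfolding K_def using that assms by (intro member_le_sum) auto
  show "(\<lambda>n. measure_pmf.prob (IAC A n) (situation_event (\<lambda>P.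
      winners A (dr_score A P) = winners A (dodgson_score A P) \<and>
      winners A (dc_score A P) = winners A (dodgson_score A P) \<and>
      winners A (dand_score A P) = winners A (dodgson_score A P)))) \<longlonglongrightarrow> 1"
    by (rule steep_score.almost_all_situations[OF steep_score_dodgson assms, where K = "2 * K"])
       (intro conjI winners_dodgson_relaxations[OF assms _ K])
qed

end
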